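(* Let $\{c(\beta):\beta\in\mathbb{Q}/\mathbb{Z}\}$ be real numbers such that $\beta\mapsto c(\beta)h(\beta)$ is bounded on $\mathbb{Q}/\mathbb{Z}$. For $q\ge1$ put $U_q(x)=\sum_{h(\beta)=q}c(\beta)f_\beta(x)$. Define three sets of points $\alpha\in\mathbb{R}/\mathbb{Z}$: - $\mathcal{C}$ is the set where $\lim_{Q\to\infty}\sum_{q=1}^QU_q(\alpha)$ exists and is finite; - $\mathcal{D}$ is the set where $\liminf_{Q\to\infty}\sum_{q=1}^QU_q(\alpha)=-\infty$ and $\limsup_{Q\to\infty}\sum_{q=1}^QU_q(\alpha)=+\infty$; - $\mathcal{E}$ is the set where $\sum_{q=1}^\infty U_q(\alpha)^2<\infty$. Then, with $|\cdot|$ denoting Haar measure: (i) $|\mathcal{C}\cup\mathcal{D}|=1$; (ii) $|\mathcal{C}\setminus\mathcal{E}|=0$; (iii) $|\mathcal{E}\setminus\mathcal{C}|=0$.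
   Context: Every $\beta\in\mathbb{Q}/\mathbb{Z}$ can be written $\beta=a/q$ with $q\ge1$ and $\gcd(a,q)=1$; its height is $h(\beta)=q$. Put $\mathcal{F}_Q=\{\beta:h(\beta)\le Q\}$. For distinct $a,b\in\mathbb{R}/\mathbb{Z}$, $I(a,b)$ is the open arc from $a$ to $b$ in the positive direction, i.e. $\{a+t\bmod1:0<t<d\}$ with $d\in(0,1)$, $d\equiv b-a\pmod1$. For $\beta\ne0$ with $h(\beta)=Q$: $\beta'$ is the unique point of $\mathcal{F}_Q$ with $I(\beta',\beta)\cap\mathcal{F}_Q=\emptyset$, and $\beta''$ is the unique point of $\mathcal{F}_Q$ with $I(\beta,\beta'')\cap\mathcal{F}_Q=\emptyset$. Let $\psi(x)=x-[x]-\frac12$ for $x\notin\mathbb{Z}$ and $\psi(x)=0$ for $x\in\mathbb{Z}$. Define $f_0\equiv1$ and, for $\beta\ne0$, $f_\beta(x)=h(\beta)\psi(x-\beta)-h(\beta')\psi(x-\beta')-h(\beta'')\psi(x-\beta'')$. *)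

theory Defs
  imports "HOL-Analysis.Analysis"
begin

text \<open>
  The circle \<open>\<real>/\<int>\<close> is represented by the fundamental domain \<open>[0,1)\<close> in \<^typ>\<open>real\<close>, and
  \<open>\<rat>/\<int>\<close> by \<open>[0,1)\<close> in \<^typ>\<open>rat\<close>; reduction modulo 1 is \<^const>\<open>frac\<close>. Under this
  identification the normalised Haar measure of \<open>\<real>/\<int>\<close> is Lebesgue measure on \<open>[0,1)\<close>.
\<close>

definition circle :: "real set" where
  "circle = {0..<1}"

definition circle_haar :: "real measure" where
  "circle_haar = restrict_space lborel circle"

definition rat_circle :: "rat set" where
  "rat_circle = {0..<1}"

text \<open>\<^const>\<open>quotient_of\<close> returns the reduced fraction with positive denominator.\<close>

definition height :: "rat \<Rightarrow> nat" where
  "height \<beta> = nat (snd (quotient_of \<beta>))"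

definition farey :: "nat \<Rightarrow> rat set" where
  "farey Q = {\<beta> \<in> rat_circle. height \<beta> \<le> Q}"

text \<open>Only meant for \<open>a\<close> and \<open>b\<close> that are distinct modulo 1.\<close>

definition pos_arc :: "real \<Rightarrow> real \<Rightarrow> real set" where
  "pos_arc a b = {frac (a + t) | t. 0 < t \<and> t < frac (b - a)}"

definition left_nbr :: "rat \<Rightarrow> rat" where
  "left_nbr \<beta> = (THE \<gamma>. \<gamma> \<in> farey (height \<beta>) \<and> \<gamma> \<noteq> \<beta> \<and>
     pos_arc (of_rat \<gamma>) (of_rat \<beta>) \<inter> of_rat ` farey (height \<beta>) = {})"

definition right_nbr :: "rat \<Rightarrow> rat" where
  "right_nbr \<beta> = (THE \<gamma>. \<gamma> \<in> farey (height \<beta>) \<and> \<gamma> \<noteq> \<beta> \<and>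
     pos_arc (of_rat \<beta>) (of_rat \<gamma>) \<inter> of_rat ` farey (height \<beta>) = {})"

definition psi :: "real \<Rightarrow> real" where
  "psi x = (if x \<in> \<int> then 0 else x - of_int \<lfloor>x\<rfloor> - 1 / 2)"

definition f_beta :: "rat \<Rightarrow> real \<Rightarrow> real" where
  "f_beta \<beta> x = (if \<beta> = 0 then 1 else
      real (height \<beta>) * psi (x - of_rat \<beta>)
    - real (height (left_nbr \<beta>)) * psi (x - of_rat (left_nbr \<beta>))
    - real (height (right_nbr \<beta>)) * psi (x - of_rat (right_nbr \<beta>)))"

definition U_level :: "(rat \<Rightarrow> real) \<Rightarrow> nat \<Rightarrow> real \<Rightarrow> real" where
  "U_level c q x = (\<Sum>\<beta> | \<beta> \<in> rat_circle \<and> height \<beta> = q. c \<beta> * f_beta \<beta> x)"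

definition set_C :: "(rat \<Rightarrow> real) \<Rightarrow> real set" where
  "set_C c = {\<alpha> \<in> circle. convergent (\<lambda>Q. \<Sum>q=1..Q. U_level c q \<alpha>)}"

definition set_D :: "(rat \<Rightarrow> real) \<Rightarrow> real set" where
  "set_D c = {\<alpha> \<in> circle.
     liminf (\<lambda>Q. ereal (\<Sum>q=1..Q. U_level c q \<alpha>)) = -\<infinity> \<and>
     limsup (\<lambda>Q. ereal (\<Sum>q=1..Q. U_level c q \<alpha>)) = \<infinity>}"

definition set_E :: "(rat \<Rightarrow> real) \<Rightarrow> real set" where
  "set_E c = {\<alpha> \<in> circle. summable (\<lambda>n. (U_level c (Suc n) \<alpha>)\<^sup>2)}"

text \<open>
  The sums in \<^const>\<open>U_level\<close> are finite, and the descriptions of the two neighbours are uniquely satisfied.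
\<close>

lemma finite_farey: "finite (farey Q)"
proof -
  have "farey Q \<subseteq> (\<lambda>(a, b). of_int a / of_int b) ` ({0..int Q} \<times> {1..int Q})"
  proof
    fix \<beta> assume "\<beta> \<in> farey Q"
    then have b: "0 \<le> \<beta>" "\<beta> < 1" "height \<beta> \<le> Q"
      by (auto simp: farey_def rat_circle_def)
    obtain p q where pq: "quotient_of \<beta> = (p, q)"
      by force
    have q: "q > 0"
      using quotient_of_denom_pos[OF pq] .
    have eq: "\<beta> = of_int p / of_int q"
      using quotient_of_div[OF pq] .
    have qQ: "q \<le> int Q"
      using b(3) q pq by (simp add: height_def)
    have "0 \<le> p" "p < q"
      using b(1,2) q unfolding eq by (simp_all add: zero_le_divide_iff)
    then show "\<beta> \<in> (\<lambda>(a, b). of_int a / of_int b) ` ({0..int Q} \<times> {1..int Q})"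
      using q qQ eq by (auto intro!: image_eqI[of _ _ "(p, q)"])
  qed
  then show ?thesis
    by (rule finite_subset) auto
qed

lemma finite_height_eq: "finite {\<beta> \<in> rat_circle. height \<beta> = q}"
  by (rule finite_subset[OF _ finite_farey[of q]]) (auto simp: farey_def)

lemma frac_diff_cases:
  fixes a b :: real
  assumes "a \<in> {0..<1}" "b \<in> {0..<1}"
  shows "frac (b - a) = (if a \<le> b then b - a else b - a + 1)"
  using assms by (auto simp: frac_unique_iff)

lemma frac_diff_inj:
  fixes a b x :: real
  assumes "a \<in> {0..<1}" "b \<in> {0..<1}" "x \<in> {0..<1}"
  shows "frac (x - a) = frac (x - b) \<longleftrightarrow> a = b" "frac (a - x) = frac (b - x) \<longleftrightarrow> a = b"
  using assms by (auto simp: frac_diff_cases)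

lemma mem_pos_arc_iff:
  assumes "a \<in> {0..<1}" "b \<in> {0..<1}" "x \<in> {0..<1}"
  shows "x \<in> pos_arc a b \<longleftrightarrow> x \<noteq> a \<and> frac (x - a) < frac (b - a)"
proof
  assume "x \<in> pos_arc a b"
  then obtain t where t: "x = frac (a + t)" "0 < t" "t < frac (b - a)"
    by (auto simp: pos_arc_def)
  have "t < 1"
    using t(3) frac_lt_1[of "b - a"] by linarith
  have "x = (if a + t < 1 then a + t else a + t - 1)"
    using t \<open>t < 1\<close> assms(1) by (auto simp: frac_unique_iff)
  then show "x \<noteq> a \<and> frac (x - a) < frac (b - a)"
    using t \<open>t < 1\<close> assms frac_diff_cases[of a x] by (auto split: if_splits)
next
  assume x: "x \<noteq> a \<and> frac (x - a) < frac (b - a)"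
  have "x = frac (a + frac (x - a))"
    using assms frac_diff_cases[of a x] by (auto simp: frac_unique_iff split: if_splits)
  moreover have "0 < frac (x - a)"
    using x assms frac_diff_cases[of a x] by (auto split: if_splits)
  ultimately show "x \<in> pos_arc a b"
    using x unfolding pos_arc_def by blast
qed

lemma mem_pos_arc_iff':
  assumes "a \<in> {0..<1}" "b \<in> {0..<1}" "x \<in> {0..<1}" "a \<noteq> b"
  shows "x \<in> pos_arc a b \<longleftrightarrow> x \<noteq> b \<and> frac (b - x) < frac (b - a)"
  unfolding mem_pos_arc_iff[OF assms(1-3)]
  using assms by (auto simp: frac_diff_cases)

lemma ex1_minimiser:
  fixes S :: "rat set" and g :: "rat \<Rightarrow> real"
  assumes "finite S" "S \<noteq> {}" "inj_on g S"
  shows "\<exists>!\<gamma>. \<gamma> \<in> S \<and> (\<forall>x\<in>S. \<not> g x < g \<gamma>)"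
proof -
  have "\<exists>\<gamma>\<in>S. \<forall>x\<in>S. g \<gamma> \<le> g x"
    using assms(1,2) by (metis arg_min_least arg_min_if_finite(1))
  then show ?thesis
    using assms(3) by (metis inj_onD linorder_not_le order_antisym)
qed

lemma farey_mem:
  assumes "x \<in> farey Q"
  shows "real_of_rat x \<in> {0..<1}"
  using assms by (auto simp: farey_def rat_circle_def)

lemma zero_mem_farey:
  assumes "Q \<ge> 1"
  shows "0 \<in> farey Q"
  using assms by (simp add: farey_def rat_circle_def height_def)

lemma height_pos: "height \<beta> \<ge> 1"
  using quotient_of_denom_pos'[of \<beta>] by (simp add: height_def)

lemma left_nbr_ex1:
  assumes "\<beta> \<in> rat_circle" "\<beta> \<noteq> 0"
  shows "\<exists>!\<gamma>. \<gamma> \<in> farey (height \<beta>) \<and> \<gamma> \<noteq> \<beta> \<and>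
     pos_arc (of_rat \<gamma>) (of_rat \<beta>) \<inter> of_rat ` farey (height \<beta>) = {}"
proof -
  define F where "F = farey (height \<beta>)"
  define g where "g x = frac (real_of_rat \<beta> - real_of_rat x)" for x
  have bF: "\<beta> \<in> F"
    using assms by (simp add: F_def farey_def)
  have mem: "real_of_rat x \<in> {0..<1}" if "x \<in> F" for x
    using that farey_mem by (simp add: F_def)
  have inj: "inj_on g (F - {\<beta>})"
  proof (rule inj_onI)
    fix x y assume "x \<in> F - {\<beta>}" "y \<in> F - {\<beta>}" "g x = g y"
    then show "x = y"
      using mem[of x] mem[of y] mem[OF bF] by (simp add: g_def frac_diff_inj)
  qed
  have arc: "of_rat x \<in> pos_arc (of_rat \<gamma>) (of_rat \<beta>) \<longleftrightarrow> x \<in> F - {\<beta>} \<and> g x < g \<gamma>"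
    if "x \<in> F" "\<gamma> \<in> F - {\<beta>}" for x \<gamma>
    using that mem[of x] mem[of \<gamma>] mem[OF bF]
    by (subst mem_pos_arc_iff') (auto simp: g_def)
  have "0 \<in> F - {\<beta>}"
    using assms zero_mem_farey[OF height_pos] by (simp add: F_def)
  then have "\<exists>!\<gamma>. \<gamma> \<in> F - {\<beta>} \<and> (\<forall>x\<in>F - {\<beta>}. \<not> g x < g \<gamma>)"
    by (intro ex1_minimiser inj) (auto simp: F_def finite_farey)
  moreover have "\<gamma> \<in> F - {\<beta>} \<and> (\<forall>x\<in>F - {\<beta>}. \<not> g x < g \<gamma>) \<longleftrightarrow>
      \<gamma> \<in> F \<and> \<gamma> \<noteq> \<beta> \<and> pos_arc (of_rat \<gamma>) (of_rat \<beta>) \<inter> of_rat ` F = {}" for \<gamma>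
    using arc by blast
  ultimately show ?thesis
    by (simp add: F_def)
qed

lemma right_nbr_ex1:
  assumes "\<beta> \<in> rat_circle" "\<beta> \<noteq> 0"
  shows "\<exists>!\<gamma>. \<gamma> \<in> farey (height \<beta>) \<and> \<gamma> \<noteq> \<beta> \<and>
     pos_arc (of_rat \<beta>) (of_rat \<gamma>) \<inter> of_rat ` farey (height \<beta>) = {}"
proof -
  define F where "F = farey (height \<beta>)"
  define g where "g x = frac (real_of_rat x - real_of_rat \<beta>)" for x
  have bF: "\<beta> \<in> F"
    using assms by (simp add: F_def farey_def)
  have mem: "real_of_rat x \<in> {0..<1}" if "x \<in> F" for x
    using that farey_mem by (simp add: F_def)
  have inj: "inj_on g (F - {\<beta>})"
  proof (rule inj_onI)
    fix x y assume "x \<in> F - {\<beta>}" "y \<in> F - {\<beta>}" "g x = g y"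
    then show "x = y"
      using mem[of x] mem[of y] mem[OF bF] by (simp add: g_def frac_diff_inj)
  qed
  have arc: "of_rat x \<in> pos_arc (of_rat \<beta>) (of_rat \<gamma>) \<longleftrightarrow> x \<in> F - {\<beta>} \<and> g x < g \<gamma>"
    if "x \<in> F" "\<gamma> \<in> F - {\<beta>}" for x \<gamma>
    using that mem[of x] mem[of \<gamma>] mem[OF bF]
    by (subst mem_pos_arc_iff) (auto simp: g_def)
  have "0 \<in> F - {\<beta>}"
    using assms zero_mem_farey[OF height_pos] by (simp add: F_def)
  then have "\<exists>!\<gamma>. \<gamma> \<in> F - {\<beta>} \<and> (\<forall>x\<in>F - {\<beta>}. \<not> g x < g \<gamma>)"
    by (intro ex1_minimiser inj) (auto simp: F_def finite_farey)
  moreover have "\<gamma> \<in> F - {\<beta>} \<and> (\<forall>x\<in>F - {\<beta>}. \<not> g x < g \<gamma>) \<longleftrightarrow>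
      \<gamma> \<in> F \<and> \<gamma> \<noteq> \<beta> \<and> pos_arc (of_rat \<beta>) (of_rat \<gamma>) \<inter> of_rat ` F = {}" for \<gamma>
    using arc by blast
  ultimately show ?thesis
    by (simp add: F_def)
qed

end

theory Submission imports Defs "HOL-Probability.Conditional_Expectation" begin

text \<open>
  If \<open>\<beta>\<close> has height \<open>q\<close> and its neighbours have heights \<open>q'\<close> and \<open>q''\<close>, then \<open>q = q' + q''\<close>, so the
  linear parts in \<open>f\<^sub>\<beta>\<close> cancel: off the rationals \<open>f\<^sub>\<beta>\<close> equals \<open>q'\<close> on the arc \<open>(\<beta>', \<beta>)\<close> of length
  \<open>1/(q q')\<close>, \<open>-q''\<close> on the arc \<open>(\<beta>, \<beta>'')\<close> of length \<open>1/(q q'')\<close>, and 0 elsewhere. As \<open>(\<beta>', \<beta>'')\<close> is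
  an atom of the algebra generated by the arcs of \<open>\<F>\<^bsub>q-1\<^esub>\<close>, the functions \<open>U\<^sub>q\<close>, \<open>q \<ge> 2\<close>, are martingale
  differences for these algebras, and they are uniformly bounded because the supports of the \<open>f\<^sub>\<beta>\<close> with
  \<open>h(\<beta>) = q\<close> are disjoint. The theorem is then the classical dichotomy for martingales with bounded
  increments: stopping when the partial sums leave an interval, or when the sum of squares exceeds a
  threshold, gives an \<open>L\<^sup>2\<close>-bounded martingale, which converges almost everywhere by Kolmogorov's
  maximal inequality.
\<close>

section \<open>Martingales with bounded increments\<close>

text \<open>The condition under the sum is inherited by smaller \<open>i\<close>, so the surviving
  terms form an initial segment; \<open>k\<close> is the first failure of \<open>Q\<close>, capped
  at \<open>n\<close>. This handles stopped sums without stopping times.\<close>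

lemma stopped_sum:
  fixes a :: "nat \<Rightarrow> real"
  shows "\<exists>k\<le>n. (\<Sum>i<n. if \<forall>j\<le>i. Q j then a i else 0) = sum a {..<k}
           \<and> (\<forall>j<k. Q j) \<and> (k < n \<longrightarrow> \<not> Q k)"
proof (induction n)
  case 0
  then show ?case by auto
next
  case (Suc n)
  then obtain k where k: "k \<le> n" "(\<Sum>i<n. if \<forall>j\<le>i. Q j then a i else 0) = sum a {..<k}"
    "\<forall>j<k. Q j" "k < n \<longrightarrow> \<not> Q k" by blast
  show ?case
  proof (cases "\<forall>j\<le>n. Q j")
    case True
    then have "k = n" using k by (metis le_neq_implies_less less_imp_le)
    then show ?thesis using k True by (intro exI[of _ "Suc n"]) (auto simp: less_Suc_eq_le)
  next
    case False
    have "\<not> Q k"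
    proof (cases "k = n")
      case True
      then show ?thesis using False k(3) by (metis le_neq_implies_less)
    qed (use k in auto)
    then show ?thesis using k False by (intro exI[of _ k]) auto
  qed
qed

text \<open>\<open>X n\<close> is the increment from time \<open>n\<close> to \<open>n + 1\<close>:
  known at time \<open>n + 1\<close>, with mean zero given \<open>F n\<close>.
  \<open>centered\<close> expresses the latter by set integrals, a form that can be checked on
  atoms.\<close>

locale bounded_martingale_differences = prob_space M for M :: "'a measure" +
  fixes F :: "nat \<Rightarrow> 'a measure" and X :: "nat \<Rightarrow> 'a \<Rightarrow> real" and B :: real
  assumes subalg: "subalgebra M (F n)"
    and filtration: "m \<le> n \<Longrightarrow> sets (F m) \<subseteq> sets (F n)"
    and adapted: "X n \<in> borel_measurable (F (Suc n))"
    and increment_bound: "x \<in> space M \<Longrightarrow> \<bar>X n x\<bar> \<le> B"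
    and centered: "A \<in> sets (F n) \<Longrightarrow> (\<integral>x\<in>A. X n x \<partial>M) = 0"
begin

definition S :: "nat \<Rightarrow> 'a \<Rightarrow> real" where
  "S n x = (\<Sum>i<n. X i x)"

lemma bound_nonneg: "0 \<le> B"
proof -
  obtain x where "x \<in> space M" using not_empty by blast
  then show ?thesis using increment_bound[of x 0] by linarith
qed

lemma space_F [simp]: "space (F n) = space M"
  using subalg by (simp add: subalgebra_def)

lemma measurable_F_mono:
  assumes "f \<in> measurable (F m) N" "m \<le> n"
  shows "f \<in> measurable (F n) N"
  using assms(1) filtration[OF assms(2)] unfolding measurable_def by auto

lemma measurable_F_imp_M:
  assumes "f \<in> measurable (F m) N"
  shows "f \<in> measurable M N"
  using measurable_from_subalg[OF subalg assms] .

lemma measurable_X [measurable]: "X n \<in> borel_measurable M"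
  using adapted measurable_F_imp_M by blast

lemma S_adapted: "S n \<in> borel_measurable (F n)"
proof -
  have "X i \<in> borel_measurable (F n)" if "i < n" for i
    by (rule measurable_F_mono[OF adapted]) (use that in simp)
  then show ?thesis unfolding S_def by auto
qed

lemma measurable_S [measurable]: "S n \<in> borel_measurable M"
  using S_adapted measurable_F_imp_M by blast

lemma abs_S_le: "x \<in> space M \<Longrightarrow> \<bar>S n x\<bar> \<le> n * B"
proof -
  assume x: "x \<in> space M"
  have "\<bar>S n x\<bar> \<le> (\<Sum>i<n. \<bar>X i x\<bar>)" unfolding S_def by (rule sum_abs)
  also have "\<dots> \<le> (\<Sum>i<n. B)" by (intro sum_mono increment_bound x)
  finally show ?thesis by simp
qed

lemma integrable_bounded:
  fixes f :: "'a \<Rightarrow> real"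
  assumes "f \<in> borel_measurable M" "\<And>x. x \<in> space M \<Longrightarrow> \<bar>f x\<bar> \<le> K"
  shows "integrable M f"
  using assms by (intro integrable_const_bound[where B=K]) (auto intro!: AE_I2)

lemma integrable_X: "integrable M (X n)"
  by (rule integrable_bounded[OF measurable_X increment_bound])

lemma integrable_X2: "integrable M (\<lambda>x. (X n x)\<^sup>2)"
proof (rule integrable_bounded[where K="B\<^sup>2"])
  fix x assume "x \<in> space M"
  then show "\<bar>(X n x)\<^sup>2\<bar> \<le> B\<^sup>2"
    using increment_bound[of x n] by (simp add: abs_le_square_iff[symmetric] bound_nonneg)
qed auto

lemma integrable_S: "integrable M (S n)"
  by (rule integrable_bounded[OF measurable_S abs_S_le])

lemma integrable_S2: "integrable M (\<lambda>x. (S n x)\<^sup>2)"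
proof (rule integrable_bounded[where K="(n * B)\<^sup>2"])
  fix x assume "x \<in> space M"
  then show "\<bar>(S n x)\<^sup>2\<bar> \<le> (real n * B)\<^sup>2"
    using abs_S_le[of x n] by (simp add: abs_le_square_iff[symmetric] bound_nonneg)
qed auto

text \<open>\<open>centered\<close> only tests against sets in \<open>F n\<close>. It forces the
  conditional expectation of \<open>X n\<close> given \<open>F n\<close> to vanish, and a bounded
  \<open>F n\<close>-measurable factor can be pulled out of it.\<close>

lemma predictable_orthogonal:
  assumes h: "h \<in> borel_measurable (F n)" and K: "\<And>x. x \<in> space M \<Longrightarrow> \<bar>h x\<bar> \<le> K"
  shows "integrable M (\<lambda>x. h x * X n x)" "(\<integral>x. h x * X n x \<partial>M) = 0"
proof -
  interpret sa: sigma_finite_subalgebra M "F n"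
    by (rule finite_measure_subalgebra_is_sigma_finite)
      (auto simp: finite_measure_subalgebra_def finite_measure_subalgebra_axioms_def subalg
        finite_measure_axioms)
  have [measurable]: "h \<in> borel_measurable M" using h measurable_F_imp_M by blast
  have hK: "\<bar>h x * X n x\<bar> \<le> K * B" if "x \<in> space M" for x
    using K[OF that] increment_bound[OF that, of n] unfolding abs_mult
    by (intro mult_mono) auto
  show int: "integrable M (\<lambda>x. h x * X n x)"
    by (rule integrable_bounded[OF _ hK]) auto
  have "AE x in M. real_cond_exp M (F n) (X n) x = 0"
    by (rule sa.real_cond_exp_charact) (auto simp: integrable_X centered)
  then have "(\<integral>x. h x * real_cond_exp M (F n) (X n) x \<partial>M) = (\<integral>x. 0 \<partial>M)"
    by (intro integral_cong_AE) auto
  moreover have "(\<integral>x. h x * real_cond_exp M (F n) (X n) x \<partial>M) = (\<integral>x. h x * X n x \<partial>M)"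
    by (rule sa.real_cond_exp_intg(2)[OF int h]) auto
  ultimately show "(\<integral>x. h x * X n x \<partial>M) = 0" by simp
qed

lemma expectation_S: "(\<integral>x. S n x \<partial>M) = 0"
proof -
  have "(\<integral>x. X i x \<partial>M) = 0" for i
    using predictable_orthogonal(2)[of "\<lambda>_. 1" i 1] by simp
  then show ?thesis unfolding S_def by (simp add: integrable_X)
qed

lemma expectation_S2: "(\<integral>x. (S n x)\<^sup>2 \<partial>M) = (\<Sum>i<n. \<integral>x. (X i x)\<^sup>2 \<partial>M)"
proof (induction n)
  case 0
  then show ?case by (simp add: S_def)
next
  case (Suc n)
  \<comment> \<open>The cross term vanishes because \<open>S n\<close> is
    \<open>F n\<close>-measurable and bounded by \<open>n * B\<close>.\<close>
  note o = predictable_orthogonal[OF S_adapted abs_S_le, of n]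
  have "(S (Suc n) x)\<^sup>2 = (S n x)\<^sup>2 + (2 * (S n x * X n x) + (X n x)\<^sup>2)" for x
    by (simp add: S_def power2_eq_square algebra_simps)
  then have "(\<integral>x. (S (Suc n) x)\<^sup>2 \<partial>M) =
      (\<integral>x. (S n x)\<^sup>2 \<partial>M) + (2 * (\<integral>x. S n x * X n x \<partial>M) + (\<integral>x. (X n x)\<^sup>2 \<partial>M))"
    using o(1) integrable_S2 integrable_X2 by simp
  then show ?case using Suc o(2) by simp
qed

section \<open>Shifted, negated, restricted and stopped martingales\<close>

lemma shifted_martingale_differences: "bounded_martingale_differences M (\<lambda>n. F (m + n)) (\<lambda>n. X (m + n)) B"
proof unfold_locales
  show "X (m + n) \<in> borel_measurable (F (m + Suc n))" for n
    using adapted[of "m + n"] by simp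
  show "sets (F (m + k)) \<subseteq> sets (F (m + n))" if "k \<le> n" for k n
    by (rule filtration) (use that in simp)
qed (fact subalg increment_bound centered)+

lemma uminus_martingale_differences: "bounded_martingale_differences M F (\<lambda>n x. - X n x) B"
proof unfold_locales
  show "(\<lambda>x. - X n x) \<in> borel_measurable (F (Suc n))" for n
    using adapted[of n] by (rule borel_measurable_uminus)
  show "\<bar>- X n x\<bar> \<le> B" if "x \<in> space M" for n x
    using increment_bound[OF that, of n] by simp
  show "(\<integral>x\<in>A. - X n x \<partial>M) = 0" if "A \<in> sets (F n)" for A n
    using centered[OF that] by (simp add: set_lebesgue_integral_def)
qed (fact subalg filtration)+

text \<open>\<open>P n\<close> is decided at time \<open>n\<close>, so intersecting a test set from
  \<open>F n\<close> with it stays in \<open>F n\<close>, and \<open>centered\<close> carries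
  over.\<close>

lemma restricted_martingale_differences:
  assumes P: "\<And>n. Measurable.pred (F n) (P n)"
  shows "bounded_martingale_differences M F (\<lambda>n x. if P n x then X n x else 0) B"
proof unfold_locales
  show "(\<lambda>x. if P n x then X n x else 0) \<in> borel_measurable (F (Suc n))" for n
  proof -
    have [measurable]: "Measurable.pred (F (Suc n)) (P n)"
      by (rule measurable_F_mono[OF P]) simp
    note adapted[of n, measurable]
    show ?thesis by measurable
  qed
  show "(\<integral>x\<in>A. (if P n x then X n x else 0) \<partial>M) = 0" if A: "A \<in> sets (F n)" for A n
  proof -
    have "A \<inter> {x\<in>space (F n). P n x} \<in> sets (F n)"
      using A P by (intro sets.Int) (auto simp: pred_def)
    then have "(\<integral>x\<in>A \<inter> {x\<in>space (F n). P n x}. X n x \<partial>M) = 0" by (rule centered)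
    moreover have "(\<integral>x\<in>A \<inter> {x\<in>space (F n). P n x}. X n x \<partial>M) = (\<integral>x\<in>A. (if P n x then X n x else 0) \<partial>M)"
      unfolding set_lebesgue_integral_def
      by (intro Bochner_Integration.integral_cong) (auto simp: indicator_def)
    ultimately show ?thesis by simp
  qed
  show "\<bar>if P n x then X n x else 0\<bar> \<le> B" if "x \<in> space M" for n x
    using increment_bound[OF that, of n] bound_nonneg by simp
qed (fact subalg filtration)+

text \<open>Whether \<open>Q\<close> held at all times up to \<open>n\<close> is known at time
  \<open>n\<close>, so stopping is a restriction. If \<open>Q j\<close> constrains the sums up to
  \<open>j\<close>, the increment that breaks it is still included: stopped quantities overshoot by
  at most one increment.\<close>

lemma stopped_martingale_differences:
  assumes Q: "\<And>n. Measurable.pred (F n) (Q n)"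
  shows "bounded_martingale_differences M F (\<lambda>n x. if \<forall>j\<le>n. Q j x then X n x else 0) B"
proof (rule restricted_martingale_differences)
  fix n
  have "Measurable.pred (F n) (Q j)" if "j \<in> {..n}" for j
    using that by (intro measurable_F_mono[OF Q]) auto
  then have "Measurable.pred (F n) (\<lambda>x. \<forall>j\<in>{..n}. Q j x)"
    by (intro pred_intros_finite) auto
  then show "Measurable.pred (F n) (\<lambda>x. \<forall>j\<le>n. Q j x)"
    by (simp only: Ball_def atMost_iff)
qed

section \<open>Kolmogorov's maximal inequality and convergence under bounded variance\<close>

lemma maximal_inequality:
  assumes "e > 0"
  shows "prob {x\<in>space M. \<exists>k\<le>n. \<bar>S k x\<bar> \<ge> e} \<le> (\<Sum>i<n. \<integral>x. (X i x)\<^sup>2 \<partial>M) / e\<^sup>2"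
proof -
  define Q where "Q j x \<longleftrightarrow> \<bar>S j x\<bar> < e" for j x
  have Q: "Measurable.pred (F j) (Q j)" for j
    unfolding Q_def using S_adapted[of j, measurable] by measurable
  interpret T: bounded_martingale_differences M F "\<lambda>n x. if \<forall>j\<le>n. Q j x then X n x else 0" B
    by (rule stopped_martingale_differences[OF Q])
  define A where "A = {x\<in>space M. \<exists>k\<le>n. \<bar>S k x\<bar> \<ge> e}"
  have [measurable]: "A \<in> sets M" unfolding A_def by measurable
  \<comment> \<open>On \<open>A\<close> the stopped sum at time \<open>n\<close> is at least
    \<open>e\<close> in absolute value. Chebyshev for the stopped sum gives the bound, since
    stopping only lowers the sum of second moments.\<close>
  have "indicator A x * e\<^sup>2 \<le> (T.S n x)\<^sup>2" for x
  proof (cases "\<exists>k\<le>n. \<bar>S k x\<bar> \<ge> e")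
    case True
    obtain k where k: "k \<le> n" "T.S n x = S k x" "\<forall>j<k. Q j x" "k < n \<longrightarrow> \<not> Q k x"
      using stopped_sum[of n "\<lambda>j. Q j x" "\<lambda>i. X i x"] by (auto simp: T.S_def S_def)
    have "\<bar>S k x\<bar> \<ge> e"
    proof (cases "k < n")
      case False
      \<comment> \<open>Here \<open>k = n\<close>: all earlier sums are below \<open>e\<close>, so
        the index given by \<open>True\<close> must be \<open>n\<close> itself.\<close>
      then show ?thesis using k True unfolding Q_def by (metis le_antisym linorder_not_le)
    qed (use k in \<open>auto simp: Q_def\<close>)
    then have "e\<^sup>2 \<le> (S k x)\<^sup>2" using assms by (simp add: abs_le_square_iff[symmetric])
    then show ?thesis using k by (auto simp: indicator_def)
  qed (auto simp: indicator_def A_def)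
  then have "(\<integral>x. indicator A x * e\<^sup>2 \<partial>M) \<le> (\<integral>x. (T.S n x)\<^sup>2 \<partial>M)"
    by (intro integral_mono T.integrable_S2 integrable_mult_left integrable_real_indicator)
      (auto simp: less_top[symmetric])
  also have "\<dots> \<le> (\<Sum>i<n. \<integral>x. (X i x)\<^sup>2 \<partial>M)"
    unfolding T.expectation_S2
    by (intro sum_mono integral_mono T.integrable_X2 integrable_X2) auto
  finally have "prob A * e\<^sup>2 \<le> (\<Sum>i<n. \<integral>x. (X i x)\<^sup>2 \<partial>M)" by simp
  moreover have "0 < e\<^sup>2" using assms by simp
  ultimately show ?thesis unfolding A_def by (simp only: pos_le_divide_eq)
qed

lemma maximal_inequality_infinite:
  assumes "e > 0" and C: "\<And>n. (\<Sum>i<n. \<integral>x. (X i x)\<^sup>2 \<partial>M) \<le> C"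
  shows "prob {x\<in>space M. \<exists>k. \<bar>S k x\<bar> \<ge> e} \<le> C / e\<^sup>2"
proof -
  define A where "A n = {x\<in>space M. \<exists>k\<le>n. \<bar>S k x\<bar> \<ge> e}" for n
  have "(\<lambda>n. prob (A n)) \<longlonglongrightarrow> prob (\<Union>n. A n)"
    by (rule finite_Lim_measure_incseq) (auto simp: A_def incseq_def intro: order_trans)
  moreover have "prob (A n) \<le> C / e\<^sup>2" for n
    using maximal_inequality[OF assms(1), of n] C[of n] divide_right_mono[OF C[of n], of "e\<^sup>2"]
    by (simp add: A_def)
  ultimately have "prob (\<Union>n. A n) \<le> C / e\<^sup>2" by (intro LIMSEQ_le_const2) auto
  moreover have "(\<Union>n. A n) = {x\<in>space M. \<exists>k. \<bar>S k x\<bar> \<ge> e}" by (auto simp: A_def)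
  ultimately show ?thesis by simp
qed

text \<open>Sum and integral can be exchanged for nonnegative terms: the sum of the squares has
  finite expectation, hence is finite almost everywhere.\<close>

lemma AE_summable_squares:
  assumes C: "\<And>n. (\<Sum>i<n. \<integral>x. (X i x)\<^sup>2 \<partial>M) \<le> C"
  shows "AE x in M. summable (\<lambda>i. (X i x)\<^sup>2)"
proof -
  have "summable (\<lambda>i. \<integral>x. (X i x)\<^sup>2 \<partial>M)"
    using C by (intro summableI_nonneg_bounded[where x=C]) auto
  then have fin: "(\<Sum>i. ennreal (\<integral>x. (X i x)\<^sup>2 \<partial>M)) \<noteq> \<infinity>"
    by (simp add: suminf_ennreal2)
  have "(\<integral>\<^sup>+x. (\<Sum>i. ennreal ((X i x)\<^sup>2)) \<partial>M) = (\<Sum>i. \<integral>\<^sup>+x. ennreal ((X i x)\<^sup>2) \<partial>M)"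
    by (intro nn_integral_suminf) auto
  also have "\<dots> = (\<Sum>i. ennreal (\<integral>x. (X i x)\<^sup>2 \<partial>M))"
    by (intro suminf_cong nn_integral_eq_integral integrable_X2) auto
  finally have "AE x in M. (\<Sum>i. ennreal ((X i x)\<^sup>2)) \<noteq> \<infinity>"
    using fin by (intro nn_integral_noteq_infinite) auto
  then show ?thesis by eventually_elim (auto intro: summable_suminf_not_top)
qed

text \<open>The maximal inequality for the sums restarted at time \<open>m\<close> bounds the
  probability of an oscillation \<open>e\<close> after \<open>m\<close> by a tail of the variance
  series over \<open>e\<^sup>2\<close>. This tends to 0, so almost every path is Cauchy.\<close>

lemma AE_convergent:
  assumes C: "\<And>n. (\<Sum>i<n. \<integral>x. (X i x)\<^sup>2 \<partial>M) \<le> C"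
  shows "AE x in M. convergent (\<lambda>n. S n x)"
proof -
  define v where "v i = (\<integral>x. (X i x)\<^sup>2 \<partial>M)" for i
  have v: "summable v"
    unfolding v_def using C by (intro summableI_nonneg_bounded[where x=C]) auto
  have osc: "AE x in M. \<exists>m. \<forall>k. \<bar>S (m + k) x - S m x\<bar> < e" if e: "e > 0" for e
  proof -
    define A where "A m = {x\<in>space M. \<exists>k. \<bar>S (m + k) x - S m x\<bar> \<ge> e}" for m
    have [measurable]: "A m \<in> sets M" for m unfolding A_def by measurable
    have A: "prob (A m) \<le> (\<Sum>i. v (i + m)) / e\<^sup>2" for m
    proof -
      interpret T: bounded_martingale_differences M "\<lambda>n. F (m + n)" "\<lambda>n. X (m + n)" B by (rule shifted_martingale_differences)
      have "T.S k x = S (m + k) x - S m x" for k x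
        by (induction k) (auto simp: T.S_def S_def)
      moreover have "(\<Sum>i<n. v (m + i)) \<le> (\<Sum>i. v (i + m))" for n
        using sum_le_suminf[OF summable_ignore_initial_segment[OF v], of "{..<n}" m]
        by (simp add: add.commute v_def)
      ultimately show ?thesis
        using T.maximal_inequality_infinite[OF e, of "\<Sum>i. v (i + m)"] by (simp add: A_def v_def)
    qed
    have "(\<lambda>m. (\<Sum>i. v (i + m)) / e\<^sup>2) \<longlonglongrightarrow> 0 / e\<^sup>2"
      using suminf_exist_split2[OF v] by (intro tendsto_divide) (use e in auto)
    moreover have "prob (\<Inter>m. A m) \<le> (\<Sum>i. v (i + m)) / e\<^sup>2" for m
      by (rule order_trans[OF finite_measure_mono A]) auto
    ultimately have "prob (\<Inter>m. A m) \<le> 0"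
      by (auto intro: LIMSEQ_le_const)
    then have "prob (\<Inter>m. A m) = 0" using measure_nonneg[of M] by (metis order_antisym)
    then have "(\<Inter>m. A m) \<in> null_sets M"
      by (auto simp: null_sets_def emeasure_eq_measure)
    then show ?thesis
      by (rule AE_I') (auto simp: A_def not_less)
  qed
  have "AE x in M. \<forall>n. \<exists>m. \<forall>k. \<bar>S (m + k) x - S m x\<bar> < inverse (real (Suc n))"
    unfolding AE_all_countable using osc by simp
  then show ?thesis
  proof eventually_elim
    case (elim x)
    have "Cauchy (\<lambda>n. S n x)"
    proof (rule metric_CauchyI)
      fix e :: real assume "0 < e"
      then obtain n where n: "inverse (real (Suc n)) < e / 2"
        using reals_Archimedean[of "e/2"] by auto
      from elim obtain m where m: "\<And>k. \<bar>S (m + k) x - S m x\<bar> < inverse (real (Suc n))" by blast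
      have "dist (S p x) (S q x) < e" if "p \<ge> m" "q \<ge> m" for p q
        using m[of "p - m"] m[of "q - m"] that n by (simp add: dist_real_def)
      then show "\<exists>m. \<forall>p\<ge>m. \<forall>q\<ge>m. dist (S p x) (S q x) < e" by blast
    qed
    then show ?case by (simp add: real_Cauchy_convergent)
  qed
qed

section \<open>The dichotomy: summable squares and one-sided bounds\<close>

lemma AE_convergent_if_summable_squares:
  "AE x in M. summable (\<lambda>i. (X i x)\<^sup>2) \<longrightarrow> convergent (\<lambda>n. S n x)"
proof -
  have "AE x in M. (\<forall>n. (\<Sum>i<n. (X i x)\<^sup>2) < real K) \<longrightarrow> convergent (\<lambda>n. S n x)" for K :: nat
  proof -
    \<comment> \<open>Stop once the sum of squares reaches \<open>K\<close>; on paths where it never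
      does, the stopped and the original sums agree.\<close>
    define Q where "Q j x \<longleftrightarrow> (\<Sum>i<j. (X i x)\<^sup>2) < real K" for j x
    have Q: "Measurable.pred (F j) (Q j)" for j
    proof -
      have "X i \<in> borel_measurable (F j)" if "i < j" for i
        by (rule measurable_F_mono[OF adapted]) (use that in simp)
      then have [measurable]: "(\<lambda>x. \<Sum>i<j. (X i x)\<^sup>2) \<in> borel_measurable (F j)"
        by (intro borel_measurable_sum borel_measurable_power) auto
      show ?thesis unfolding Q_def by measurable
    qed
    interpret T: bounded_martingale_differences M F "\<lambda>n x. if \<forall>j\<le>n. Q j x then X n x else 0" B
      by (rule stopped_martingale_differences[OF Q])
    \<comment> \<open>Before the last included increment the sum of squares is below
      \<open>K\<close>, and that increment adds at most \<open>B\<^sup>2\<close>.\<close>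
    have pt: "(\<Sum>i<n. (if \<forall>j\<le>i. Q j x then X i x else 0)\<^sup>2) \<le> K + B\<^sup>2" if x: "x \<in> space M" for n x
    proof -
      obtain k where k: "k \<le> n" "\<forall>j<k. Q j x"
        "(\<Sum>i<n. if \<forall>j\<le>i. Q j x then (X i x)\<^sup>2 else 0) = (\<Sum>i<k. (X i x)\<^sup>2)"
        using stopped_sum[of n "\<lambda>j. Q j x" "\<lambda>i. (X i x)\<^sup>2"] by auto
      have "(\<Sum>i<k. (X i x)\<^sup>2) \<le> K + B\<^sup>2"
      proof (cases k)
        case (Suc l)
        moreover have "(X l x)\<^sup>2 \<le> B\<^sup>2"
          using increment_bound[OF x, of l] bound_nonneg by (simp add: abs_le_square_iff[symmetric])
        ultimately show ?thesis using k(2) by (auto simp: Q_def)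
      qed auto
      moreover have "(\<Sum>i<n. (if \<forall>j\<le>i. Q j x then X i x else 0)\<^sup>2)
          = (\<Sum>i<n. if \<forall>j\<le>i. Q j x then (X i x)\<^sup>2 else 0)"
        by (intro sum.cong) auto
      ultimately show ?thesis using k(3) by linarith
    qed
    have "(\<Sum>i<n. \<integral>x. (if \<forall>j\<le>i. Q j x then X i x else 0)\<^sup>2 \<partial>M) \<le> K + B\<^sup>2" for n
    proof -
      have "(\<Sum>i<n. \<integral>x. (if \<forall>j\<le>i. Q j x then X i x else 0)\<^sup>2 \<partial>M)
          = (\<integral>x. (\<Sum>i<n. (if \<forall>j\<le>i. Q j x then X i x else 0)\<^sup>2) \<partial>M)"
        by (rule Bochner_Integration.integral_sum[symmetric]) (rule T.integrable_X2)
      also have "\<dots> \<le> (\<integral>x. K + B\<^sup>2 \<partial>M)"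
        by (intro integral_mono Bochner_Integration.integrable_sum T.integrable_X2 pt) auto
      finally show ?thesis by (simp add: prob_space)
    qed
    from T.AE_convergent[OF this] show ?thesis
    proof eventually_elim
      case (elim x)
      show ?case
      proof
        assume "\<forall>n. (\<Sum>i<n. (X i x)\<^sup>2) < real K"
        then have "\<forall>n. Q n x" by (simp add: Q_def)
        then show "convergent (\<lambda>n. S n x)" using elim by (simp add: T.S_def S_def)
      qed
    qed
  qed
  \<comment> \<open>Countably many thresholds cover all paths with summable squares.\<close>
  then have "AE x in M. \<forall>K. (\<forall>n. (\<Sum>i<n. (X i x)\<^sup>2) < real K) \<longrightarrow> convergent (\<lambda>n. S n x)"
    unfolding AE_all_countable by blast
  then show ?thesis
  proof eventually_elim
    case (elim x)
    show ?case
    proof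
      assume s: "summable (\<lambda>i. (X i x)\<^sup>2)"
      obtain K :: nat where "(\<Sum>i. (X i x)\<^sup>2) < real K" using reals_Archimedean2 by blast
      moreover have "(\<Sum>i<n. (X i x)\<^sup>2) \<le> (\<Sum>i. (X i x)\<^sup>2)" for n
        by (rule sum_le_suminf[OF s]) auto
      ultimately show "convergent (\<lambda>n. S n x)" using elim by (meson le_less_trans)
    qed
  qed
qed

text \<open>Both parts stop on leaving the interval from \<open>-L\<close> to \<open>K\<close>; the
  stopped sums then lie between \<open>-L - B\<close> and \<open>K + B\<close>. The first part uses
  that they are bounded in mean square, the second that their mean is zero.\<close>

lemma AE_two_sided_bounded:
  fixes K L :: real
  assumes "K > 0" "L > 0"
  shows "AE x in M. (\<forall>n. - L < S n x \<and> S n x < K) \<longrightarrow>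
           convergent (\<lambda>n. S n x) \<and> summable (\<lambda>i. (X i x)\<^sup>2)" (is ?thesis1)
    and "prob {x\<in>space M. (\<forall>n. S n x < K) \<and> (\<exists>n. S n x \<le> - L)} \<le> (K + B) / L" (is ?thesis2)
proof -
  define Q where "Q j x \<longleftrightarrow> - L < S j x \<and> S j x < K" for j x
  have Q: "Measurable.pred (F j) (Q j)" for j
    unfolding Q_def using S_adapted[of j, measurable] by measurable
  interpret T: bounded_martingale_differences M F "\<lambda>n x. if \<forall>j\<le>n. Q j x then X n x else 0" B
    by (rule stopped_martingale_differences[OF Q])
  have T: "\<exists>k\<le>n. T.S n x = S k x \<and> (\<forall>j<k. Q j x) \<and> (k < n \<longrightarrow> \<not> Q k x)
      \<and> S k x \<le> K + B \<and> - L - B \<le> S k x" if x: "x \<in> space M" for x n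
  proof -
    obtain k where k: "k \<le> n" "T.S n x = S k x" "\<forall>j<k. Q j x" "k < n \<longrightarrow> \<not> Q k x"
      using stopped_sum[of n "\<lambda>j. Q j x" "\<lambda>i. X i x"] by (auto simp: T.S_def S_def)
    have "S k x \<le> K + B \<and> - L - B \<le> S k x"
    proof (cases k)
      case 0
      then show ?thesis using assms bound_nonneg by (simp add: S_def)
    next
      case (Suc l)
      then have "S k x = S l x + X l x" "Q l x" using k by (auto simp: S_def)
      then show ?thesis using increment_bound[OF x, of l] by (auto simp: Q_def)
    qed
    with k show ?thesis by blast
  qed
  \<comment> \<open>\<open>K + L + B\<close> dominates both \<open>K + B\<close> and
    \<open>L + B\<close>.\<close>
  have "(\<Sum>i<n. \<integral>x. (if \<forall>j\<le>i. Q j x then X i x else 0)\<^sup>2 \<partial>M) \<le> (K + L + B)\<^sup>2" for n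
  proof -
    have "(T.S n x)\<^sup>2 \<le> (K + L + B)\<^sup>2" if "x \<in> space M" for x
      using T[OF that, of n] assms bound_nonneg by (auto simp: abs_le_square_iff[symmetric])
    then have "(\<integral>x. (T.S n x)\<^sup>2 \<partial>M) \<le> (\<integral>x. (K + L + B)\<^sup>2 \<partial>M)"
      by (intro integral_mono T.integrable_S2) auto
    then show ?thesis unfolding T.expectation_S2 by (simp add: prob_space)
  qed
  from T.AE_convergent[OF this] T.AE_summable_squares[OF this] show ?thesis1
  proof eventually_elim
    case (elim x)
    show ?case
    proof
      assume "\<forall>n. - L < S n x \<and> S n x < K"
      then have "\<forall>n. Q n x" by (simp add: Q_def)
      then show "convergent (\<lambda>n. S n x) \<and> summable (\<lambda>i. (X i x)\<^sup>2)"
        using elim by (simp add: T.S_def S_def)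
    qed
  qed

  \<comment> \<open>Paths in \<open>A n\<close> never reach \<open>K\<close>, so by time
    \<open>n\<close> they have left the interval through \<open>-L\<close> and the stopped sum is at
    most \<open>-L\<close>; elsewhere it is at most \<open>K + B\<close>. As its mean is 0, this
    bounds \<open>prob (A n)\<close>.\<close>
  define A where "A n = {x\<in>space M. (\<forall>j. S j x < K) \<and> (\<exists>j\<le>n. S j x \<le> - L)}" for n
  have [measurable]: "A n \<in> sets M" for n unfolding A_def by measurable
  have "prob (A n) \<le> (K + B) / L" for n
  proof -
    have "T.S n x \<le> (K + B) - L * indicator (A n) x" if x: "x \<in> space M" for x
    proof -
      obtain k where k: "k \<le> n" "T.S n x = S k x" "\<forall>j<k. Q j x" "k < n \<longrightarrow> \<not> Q k x" "S k x \<le> K + B"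
        using T[OF x, of n] by blast
      show ?thesis
      proof (cases "x \<in> A n")
        case True
        then obtain j where j: "j \<le> n" "S j x \<le> - L" by (auto simp: A_def)
        have "\<not> j < k" using j k(3) by (auto simp: Q_def)
        then have "\<not> Q k x" using k(1,4) j by (cases "k = n") (auto simp: Q_def)
        then have "S k x \<le> - L" using True by (auto simp: A_def Q_def)
        then show ?thesis using k(2) True assms bound_nonneg by simp
      qed (use k in auto)
    qed
    moreover have int: "integrable M (\<lambda>x. L * indicator (A n) x)"
      by (intro integrable_mult_right integrable_real_indicator) (auto simp: less_top[symmetric])
    ultimately have "(\<integral>x. T.S n x \<partial>M) \<le> (\<integral>x. (K + B) - L * indicator (A n) x \<partial>M)"
      by (intro integral_mono T.integrable_S Bochner_Integration.integrable_diff integrable_const)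
    also have "\<dots> = (K + B) - L * prob (A n)"
      by (subst Bochner_Integration.integral_diff[OF integrable_const int]) (simp_all add: prob_space)
    finally show ?thesis using assms T.expectation_S by (simp add: field_simps)
  qed
  moreover have "(\<lambda>n. prob (A n)) \<longlonglongrightarrow> prob (\<Union>n. A n)"
    by (rule finite_Lim_measure_incseq) (auto simp: A_def incseq_def intro: order_trans)
  ultimately have "prob (\<Union>n. A n) \<le> (K + B) / L" by (intro LIMSEQ_le_const2) auto
  moreover have "(\<Union>n. A n) = {x\<in>space M. (\<forall>n. S n x < K) \<and> (\<exists>n. S n x \<le> - L)}"
    by (auto simp: A_def)
  ultimately show ?thesis2 by simp
qed

text \<open>The chance of staying below \<open>K\<close> and yet dropping to \<open>-L\<close> is at
  most \<open>(K + B) / L\<close>, which tends to 0 as \<open>L\<close> grows. So almost every path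
  bounded above is also bounded below, and the two-sided case applies. Thresholds
  \<open>Suc K\<close> and \<open>Suc L\<close> are positive.\<close>

lemma AE_convergent_if_bdd_above:
  "AE x in M. bdd_above (range (\<lambda>n. S n x)) \<longrightarrow>
     convergent (\<lambda>n. S n x) \<and> summable (\<lambda>i. (X i x)\<^sup>2)"
proof -
  have below: "AE x in M. (\<forall>n. S n x < real (Suc K)) \<longrightarrow> (\<exists>L. \<forall>n. - real (Suc L) < S n x)" for K :: nat
  proof -
    define A where "A L = {x\<in>space M. (\<forall>n. S n x < real (Suc K)) \<and> (\<exists>n. S n x \<le> - real (Suc L))}"
      for L :: nat
    have [measurable]: "A L \<in> sets M" for L unfolding A_def by measurable
    have "prob (\<Inter>L. A L) \<le> (real (Suc K) + B) / real (Suc L)" for L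
    proof -
      have "prob (\<Inter>L. A L) \<le> prob (A L)" by (rule finite_measure_mono) auto
      also have "\<dots> \<le> (real (Suc K) + B) / real (Suc L)"
        unfolding A_def by (rule AE_two_sided_bounded(2)) auto
      finally show ?thesis .
    qed
    moreover have "(\<lambda>L. (real (Suc K) + B) / real (Suc L)) \<longlonglongrightarrow> 0"
      by (intro LIMSEQ_Suc[OF lim_const_over_n])
    ultimately have "prob (\<Inter>L. A L) \<le> 0"
      by (auto intro: LIMSEQ_le_const)
    then have "prob (\<Inter>L. A L) = 0" using measure_nonneg[of M] by (metis order_antisym)
    then have "(\<Inter>L. A L) \<in> null_sets M"
      by (auto simp: null_sets_def emeasure_eq_measure)
    then show ?thesis
      by (rule AE_I') (auto simp: A_def not_less)
  qed
  have "AE x in M. \<forall>K L. (\<forall>n. - real (Suc L) < S n x \<and> S n x < real (Suc K)) \<longrightarrow>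
      convergent (\<lambda>n. S n x) \<and> summable (\<lambda>i. (X i x)\<^sup>2)"
    unfolding AE_all_countable by (intro allI AE_two_sided_bounded) auto
  moreover have "AE x in M. \<forall>K. (\<forall>n. S n x < real (Suc K)) \<longrightarrow> (\<exists>L. \<forall>n. - real (Suc L) < S n x)"
    unfolding AE_all_countable using below by blast
  ultimately show ?thesis
  proof eventually_elim
    case (elim x)
    show ?case
    proof
      assume "bdd_above (range (\<lambda>n. S n x))"
      then obtain b where b: "\<And>n. S n x \<le> b" by (auto simp: bdd_above_def)
      obtain K :: nat where "b < real K" using reals_Archimedean2 by blast
      then have K: "\<forall>n. S n x < real (Suc K)" using b by (smt (verit) of_nat_Suc)
      with elim(2) obtain L where "\<forall>n. - real (Suc L) < S n x" by blast
      with K elim(1) show "convergent (\<lambda>n. S n x) \<and> summable (\<lambda>i. (X i x)\<^sup>2)" by blast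
    qed
  qed
qed

lemma AE_convergent_if_bdd_below:
  "AE x in M. bdd_below (range (\<lambda>n. S n x)) \<longrightarrow>
     convergent (\<lambda>n. S n x) \<and> summable (\<lambda>i. (X i x)\<^sup>2)"
proof -
  interpret N: bounded_martingale_differences M F "\<lambda>n x. - X n x" B by (rule uminus_martingale_differences)
  have S: "N.S n x = - S n x" for n x by (simp add: N.S_def S_def sum_negf)
  have b: "bdd_below (range (\<lambda>n. S n x)) \<Longrightarrow> bdd_above (range (\<lambda>n. - S n x))" for x
    by (force simp: bdd_below_def bdd_above_def intro: le_imp_neg_le)
  show ?thesis
    using N.AE_convergent_if_bdd_above
  proof eventually_elim
    case (elim x)
    then show ?case using b[of x] convergent_minus_iff[of "\<lambda>n. S n x"] by (simp add: S)
  qed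
qed

end

section \<open>Farey neighbours\<close>

lemma height_of_int_divide:
  assumes "coprime a b" "b > 0"
  shows "int (height (of_int a / of_int b)) = b"
proof -
  have "quotient_of (of_int a / of_int b) = (a, b)"
    using assms by (simp add: Fract_of_int_quotient[symmetric] quotient_of_Fract normalize_stable)
  then show ?thesis using assms by (simp add: height_def)
qed

lemma height_fraction:
  obtains a where "x = of_int a / of_int (int (height x))" "coprime a (int (height x))"
proof -
  obtain p q where pq: "quotient_of x = (p, q)" by force
  have "int (height x) = q" using quotient_of_denom_pos[OF pq] by (simp add: height_def pq)
  then show ?thesis using that[of p] quotient_of_div[OF pq] quotient_of_coprime[OF pq] by simp
qed

text \<open>A fraction \<open>r/s\<close> strictly between two unimodular neighbours satisfies
  \<open>s = v (p s - r w) + w (r v - u s)\<close> with both brackets positive.\<close>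

lemma height_between_unimodular:
  fixes u v p w :: int
  assumes "v > 0" "w > 0" "p * v - u * w = 1"
    and "of_int u / of_int v < x" "x < of_int p / of_int w"
  shows "int (height x) \<ge> v + w"
proof -
  obtain r where r: "x = of_int r / of_int (int (height x))" using height_fraction by blast
  define s where "s = int (height x)"
  have s: "s > 0" using height_pos[of x] by (simp add: s_def)
  have x: "x = of_int r / of_int s" using r by (simp add: s_def)
  have "(of_int (u * s) :: rat) < of_int (r * v)" "(of_int (r * w) :: rat) < of_int (p * s)"
    using assms(1,2,4,5) s unfolding x by (simp_all add: field_simps)
  then have "1 \<le> r * v - u * s" "1 \<le> p * s - r * w" by linarith+
  then have "v * 1 + w * 1 \<le> v * (p * s - r * w) + w * (r * v - u * s)"
    using assms(1,2) by (intro add_mono mult_left_mono) auto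
  also have "\<dots> = s * (p * v - u * w)" by (simp add: algebra_simps)
  finally show ?thesis using assms(3) by (simp add: s_def)
qed

text \<open>0 lies in the Farey set and \<open>\<beta>\<close> is positive, so the arc from the left
  neighbour never wraps past 0 and the order on [0,1) decides.\<close>

lemma left_nbr_eqI:
  assumes "\<beta> \<in> rat_circle" "\<beta> \<noteq> 0" "\<gamma> \<in> farey (height \<beta>)" "\<gamma> < \<beta>"
    and gap: "\<And>x. x \<in> farey (height \<beta>) \<Longrightarrow> \<gamma> < x \<Longrightarrow> x < \<beta> \<Longrightarrow> False"
  shows "left_nbr \<beta> = \<gamma>"
  unfolding left_nbr_def
proof (rule the1_equality[OF left_nbr_ex1[OF assms(1,2)]], intro conjI)
  have b: "\<beta> \<in> farey (height \<beta>)" using assms(1) by (simp add: farey_def)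
  have "of_rat x \<notin> pos_arc (real_of_rat \<gamma>) (real_of_rat \<beta>)" if x: "x \<in> farey (height \<beta>)" for x
  proof
    note m = farey_mem[OF b] farey_mem[OF assms(3)] farey_mem[OF x]
    assume "of_rat x \<in> pos_arc (real_of_rat \<gamma>) (real_of_rat \<beta>)"
    then have *: "x \<noteq> \<beta>" "frac (real_of_rat \<beta> - real_of_rat x) < frac (real_of_rat \<beta> - real_of_rat \<gamma>)"
      using m assms(4) by (auto simp: mem_pos_arc_iff')
    have "g < y \<and> y \<le> b" if "b \<in> {0..<1}" "g \<in> {0..<1}" "y \<in> {0..<1}"
      "frac (b - y) < frac (b - g)" "g < b" for b g y :: real
      using that by (auto simp: frac_diff_cases split: if_splits)
    from this[OF m *(2)] have "real_of_rat \<gamma> < real_of_rat x \<and> real_of_rat x \<le> real_of_rat \<beta>"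
      using assms(4) by (simp add: of_rat_less)
    then show False using gap[OF x] *(1) by (auto simp: of_rat_less of_rat_less_eq)
  qed
  then show "pos_arc (real_of_rat \<gamma>) (real_of_rat \<beta>) \<inter> real_of_rat ` farey (height \<beta>) = {}" by blast
qed (use assms in auto)

text \<open>To the right the arc can end at 0 modulo 1. \<open>\<delta>\<close> is the endpoint
  lifted to (0,1], so that the gap condition concerns an ordinary interval.\<close>

lemma right_nbr_eqI:
  assumes "\<beta> \<in> rat_circle" "\<beta> \<noteq> 0" "\<gamma> \<in> farey (height \<beta>)" "\<gamma> = 0 \<and> \<delta> = 1 \<or> \<beta> < \<gamma> \<and> \<delta> = \<gamma>"
    and gap: "\<And>x. x \<in> farey (height \<beta>) \<Longrightarrow> \<beta> < x \<Longrightarrow> x < \<delta> \<Longrightarrow> False"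
  shows "right_nbr \<beta> = \<gamma>"
  unfolding right_nbr_def
proof (rule the1_equality[OF right_nbr_ex1[OF assms(1,2)]], intro conjI)
  have b: "\<beta> \<in> farey (height \<beta>)" using assms(1) by (simp add: farey_def)
  have b0: "0 < real_of_rat \<beta>" using assms(1,2) by (auto simp: rat_circle_def)
  have "of_rat x \<notin> pos_arc (real_of_rat \<beta>) (real_of_rat \<gamma>)" if x: "x \<in> farey (height \<beta>)" for x
  proof
    note m = farey_mem[OF b] farey_mem[OF assms(3)] farey_mem[OF x]
    assume "of_rat x \<in> pos_arc (real_of_rat \<beta>) (real_of_rat \<gamma>)"
    then have *: "x \<noteq> \<beta>" "frac (real_of_rat x - real_of_rat \<beta>) < frac (real_of_rat \<gamma> - real_of_rat \<beta>)"
      using m by (auto simp: mem_pos_arc_iff)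
    have "b \<le> y \<and> y < d" if "b \<in> {0..<1}" "g \<in> {0..<1}" "y \<in> {0..<1}"
      "frac (y - b) < frac (g - b)" "0 < b" "g = 0 \<and> d = 1 \<or> b < g \<and> d = g" for b g d y :: real
      using that by (auto simp: frac_diff_cases split: if_splits)
    from this[OF m *(2) b0, of "real_of_rat \<delta>"]
    have "real_of_rat \<beta> \<le> real_of_rat x \<and> real_of_rat x < real_of_rat \<delta>"
      using assms(4) by (auto simp: of_rat_less)
    then show False using gap[OF x] *(1) by (auto simp: of_rat_less of_rat_less_eq)
  qed
  then show "pos_arc (real_of_rat \<beta>) (real_of_rat \<gamma>) \<inter> real_of_rat ` farey (height \<beta>) = {}" by blast
qed (use assms in auto)

lemma unimodular_imp_coprime:
  fixes a b c d :: int
  assumes "a * d - b * c = 1"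
  shows "coprime a c" "coprime b d" "coprime a b" "coprime c d"
proof -
  have *: "k dvd 1" if "k dvd a * d" "k dvd b * c" for k
    using dvd_diff[OF that] assms by simp
  show "coprime a c" "coprime b d" "coprime a b" "coprime c d"
    by (rule coprimeI; rule *; simp)+
qed

text \<open>\<open>\<beta>\<close> is the mediant of \<open>u / v\<close> and \<open>p / w\<close>,
  and each two of the three fractions have determinant 1. A fraction strictly between
  \<open>\<beta>\<close> and a parent thus has height at least \<open>q + v\<close> or
  \<open>q + w\<close>, which exceeds \<open>q\<close>; so the parents are the neighbours.\<close>

lemma farey_parents:
  assumes "\<beta> \<in> rat_circle" "\<beta> \<noteq> 0"
  obtains a u v p w :: int where
    "0 < v" "0 < w" "int (height \<beta>) = v + w" "a = u + p" "0 \<le> u" "p \<le> w" "p * v - u * w = 1"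
    "\<beta> = of_int a / of_int (v + w)"
    "left_nbr \<beta> = of_int u / of_int v" "int (height (left_nbr \<beta>)) = v"
    "right_nbr \<beta> = (if p = w then 0 else of_int p / of_int w)" "int (height (right_nbr \<beta>)) = w"
proof -
  define q where "q = int (height \<beta>)"
  obtain a where a: "\<beta> = of_int a / of_int q" "coprime a q"
    using height_fraction unfolding q_def by blast
  have q0: "q > 0" using height_pos[of \<beta>] by (simp add: q_def)
  have "0 < \<beta>" "\<beta> < 1" using assms by (auto simp: rat_circle_def)
  then have a0: "0 < a" "a < q" using q0 unfolding a(1) by (simp_all add: zero_less_divide_iff)
  obtain x y where xy: "x * a + y * q = 1"
    using bezout_int[of a q] a(2) by auto
  define v where "v = x mod q"
  \<comment> \<open>Replacing the Bezout coefficient \<open>x\<close> by its residue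
    \<open>v\<close> is absorbed into \<open>u\<close>, which equals
    \<open>(a * v - 1) / q\<close>.\<close>
  define u where "u = a * (x mod q - x) div q - y"
  have "q dvd x mod q - x" by (simp add: mod_eq_dvd_iff[symmetric])
  then have "a * (x mod q - x) = q * (u + y)" by (simp add: u_def)
  then have av: "a * v - u * q = 1" using xy by (simp add: v_def algebra_simps)
  have "v \<noteq> 0"
  proof
    assume "v = 0"
    then have "q dvd 1" using av by (metis dvd_minus_iff dvd_triv_right mult_zero_right diff_0)
    then show False using a0 q0 by simp
  qed
  then have v: "0 < v" "v < q" 
    using pos_mod_sign[OF q0, of x] pos_mod_bound[OF q0, of x] by (simp_all add: v_def)
  define w where "w = q - v"
  define p where "p = a - u"
  have w: "0 < w" and qvw: "q = v + w" and apu: "a = u + p" using v by (simp_all add: w_def p_def)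
  have uni: "p * v - u * w = 1" using av unfolding qvw apu by (simp add: algebra_simps)
  have pq: "p * q - a * w = 1" using uni unfolding qvw apu by (simp add: algebra_simps)
  have "1 * 1 \<le> a * v" using a0 v by (intro mult_mono) auto
  then have "0 \<le> u * q" using av by simp
  then have u0: "0 \<le> u" using q0 by (simp add: zero_le_mult_iff)
  \<comment> \<open>From \<open>a < q\<close> it follows that \<open>p / w\<close> does not pass 1;
    equality \<open>p = w\<close> is the wrap to 0.\<close>
  have "a * w \<le> (q - 1) * w" using a0 w by (intro mult_right_mono) auto
  then have "p * q \<le> w * q" using pq w by (simp add: algebra_simps)
  then have pw: "p \<le> w" using q0 by simp
  have cop: "coprime u v" "coprime p w"
    using unimodular_imp_coprime[OF uni] by (simp_all add: coprime_commute)
  have hu: "int (height (of_int u / of_int v)) = v" and hp: "int (height (of_int p / of_int w)) = w"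
    by (rule height_of_int_divide; fact)+
  have "(of_int (u * q) :: rat) < of_int (a * v)" "(of_int (a * w) :: rat) < of_int (p * q)"
    using av pq by (simp_all only: of_int_less_iff)
  then have lt: "of_int u / of_int v < \<beta>" "\<beta> < of_int p / of_int w"
    using v w q0 unfolding a(1) by (simp_all add: field_simps)
  have L: "left_nbr \<beta> = of_int u / of_int v"
  proof (rule left_nbr_eqI[OF assms])
    show "of_int u / of_int v \<in> farey (height \<beta>)"
    proof -
      have "of_int u / of_int v < (1::rat)" using lt(1) \<open>\<beta> < 1\<close> by (rule less_trans)
      then show ?thesis using u0 v hu unfolding farey_def rat_circle_def q_def by auto
    qed
    fix x assume x: "x \<in> farey (height \<beta>)" "of_int u / of_int v < x" "x < \<beta>"
    then have "v + q \<le> int (height x)"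
      using v q0 av a(1) by (intro height_between_unimodular[of v q a u]) auto
    then show False using x(1) v by (auto simp: farey_def q_def)
  qed (fact lt)
  have R: "right_nbr \<beta> = (if p = w then 0 else of_int p / of_int w)"
  proof (rule right_nbr_eqI[OF assms, where \<delta>="of_int p / of_int w"])
    have "of_int p / of_int w \<in> farey (height \<beta>)" if "p \<noteq> w"
    proof -
      have "p < w" using pw that by simp
      moreover have "0 < p" using pq q0 a0 w
        by (metis add_pos_pos diff_add_cancel mult_pos_pos zero_less_mult_pos2 zero_less_one)
      ultimately show ?thesis using w v hp by (auto simp: farey_def rat_circle_def q_def w_def)
    qed
    then show "(if p = w then 0 else of_int p / of_int w) \<in> farey (height \<beta>)"
      using zero_mem_farey[OF height_pos] by simp
    show "(if p = w then 0 else of_int p / of_int w) = (0::rat) \<and> of_int p / of_int w = (1::rat) \<or>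
      \<beta> < (if p = w then 0 else of_int p / of_int w) \<and>
      of_int p / of_int w = (if p = w then 0 else of_int p / of_int w :: rat)"
      using w lt by simp
    fix x assume x: "x \<in> farey (height \<beta>)" "\<beta> < x" "x < of_int p / of_int w"
    then have "q + w \<le> int (height x)"
      using w q0 pq a(1) by (intro height_between_unimodular[of q w p a]) auto
    then show False using x(1) w by (auto simp: farey_def q_def)
  qed
  \<comment> \<open>If \<open>p = w\<close>, the determinant forces \<open>w = 1\<close>, which
    matches the height of the neighbour 0.\<close>
  have "int (height (right_nbr \<beta>)) = w"
  proof (cases "p = w")
    case True
    then have "w * (v - u) = 1" using uni by (simp add: algebra_simps)
    then have "w = 1" using w by (metis pos_zmult_eq_1_iff)
    then show ?thesis using True R by (simp add: height_def)
  qed (use R hp in simp)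
  moreover have "int (height (left_nbr \<beta>)) = v" unfolding L by (rule hu)
  moreover have "int (height \<beta>) = v + w" "\<beta> = of_int a / of_int (v + w)"
    using a(1) unfolding q_def[symmetric] qvw by simp_all
  ultimately show ?thesis
    using that[OF v(1) w _ apu u0 pw uni _ L _ R] by blast
qed

section \<open>Farey arcs as real intervals and step functions on them\<close>

definition left_end :: "rat \<Rightarrow> real" where
  "left_end \<beta> = of_rat (left_nbr \<beta>)"

text \<open>With 0 lifted to 1, the two ends and \<open>\<beta>\<close> are ordered along the real
  line; a left neighbour needs no lift.\<close>

definition right_end :: "rat \<Rightarrow> real" where
  "right_end \<beta> = (if right_nbr \<beta> = 0 then 1 else of_rat (right_nbr \<beta>))"

text \<open>The second identity makes the constants in \<open>f_beta\<close> cancel. The third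
  balances the two pieces of the step, both of mass \<open>1 / q\<close>. The last two facts make
  the arc part of an atom of the previous level and arcs of one level disjoint.\<close>

lemma nbr_facts:
  assumes "\<beta> \<in> rat_circle" "\<beta> \<noteq> 0"
  defines "q \<equiv> real (height \<beta>)" and "v \<equiv> real (height (left_nbr \<beta>))"
    and "w \<equiv> real (height (right_nbr \<beta>))"
  shows "q = v + w" "q * of_rat \<beta> = v * left_end \<beta> + w * right_end \<beta>"
    "v * (of_rat \<beta> - left_end \<beta>) = w * (right_end \<beta> - of_rat \<beta>)"
    "0 \<le> left_end \<beta>" "left_end \<beta> < of_rat \<beta>" "of_rat \<beta> < right_end \<beta>" "right_end \<beta> \<le> 1"
    "left_nbr \<beta> \<in> farey (height \<beta> - 1)" "right_nbr \<beta> \<in> farey (height \<beta> - 1)"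
    "\<And>x. left_end \<beta> < of_rat x \<Longrightarrow> of_rat x < right_end \<beta> \<Longrightarrow> height \<beta> \<le> height x"
    "\<And>x. left_end \<beta> < of_rat x \<Longrightarrow> of_rat x < right_end \<beta> \<Longrightarrow> height x = height \<beta> \<Longrightarrow> x = \<beta>"
proof -
  obtain a u u' p w' :: int where *:
    "0 < u'" "0 < w'" "int (height \<beta>) = u' + w'" "a = u + p" "0 \<le> u" "p \<le> w'" "p * u' - u * w' = 1"
    "\<beta> = of_int a / of_int (u' + w')"
    "left_nbr \<beta> = of_int u / of_int u'" "int (height (left_nbr \<beta>)) = u'"
    "right_nbr \<beta> = (if p = w' then 0 else of_int p / of_int w')" "int (height (right_nbr \<beta>)) = w'"
    using farey_parents[OF assms(1,2)] .
  have v: "v = real_of_int u'" and w: "w = real_of_int w'" and q: "q = real_of_int (u' + w')"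
    using *(3,10,12) unfolding q_def v_def w_def by (metis of_int_of_nat_eq)+
  show qvw: "q = v + w" using v w q by simp
  have p0: "p \<noteq> 0" using *(2,5,7) by (smt (verit) mult_eq_0_iff mult_nonneg_nonneg)
  have b: "real_of_rat \<beta> = real_of_int a / q"
    unfolding *(8) q by (simp only: of_rat_divide of_rat_of_int_eq)
  have l: "left_end \<beta> = real_of_int u / v"
    unfolding left_end_def *(9) v by (simp only: of_rat_divide of_rat_of_int_eq)
  have r: "right_end \<beta> = real_of_int p / w"
    unfolding right_end_def *(11) w using p0 *(2) by (simp add: of_rat_divide)
  have v0: "v > 0" and w0: "w > 0" and q0: "q > 0" using * by (simp_all add: v w q)
  have ra: "real_of_int a = real_of_int u + real_of_int p" using * by simp
  have uni: "real_of_int p * v - real_of_int u * w = 1"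
    unfolding v w using *(7) by (metis of_int_1 of_int_diff of_int_mult)
  show "q * of_rat \<beta> = v * left_end \<beta> + w * right_end \<beta>"
    unfolding b l r using v0 w0 q0 ra by simp
  have bl: "q * v * (of_rat \<beta> - left_end \<beta>) = 1"
  proof -
    have "q * v * (of_rat \<beta> - left_end \<beta>) = real_of_int a * v - real_of_int u * q"
      unfolding b l using v0 q0 by (simp add: field_simps)
    then show ?thesis using uni by (simp add: ra qvw algebra_simps)
  qed
  have rb: "q * w * (right_end \<beta> - of_rat \<beta>) = 1"
  proof -
    have "q * w * (right_end \<beta> - of_rat \<beta>) = real_of_int p * q - real_of_int a * w"
      unfolding b r using w0 q0 by (simp add: field_simps)
    then show ?thesis using uni by (simp add: ra qvw algebra_simps)
  qed
  have "q * (v * (of_rat \<beta> - left_end \<beta>)) = q * (w * (right_end \<beta> - of_rat \<beta>))"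
    using bl rb by (simp only: mult.assoc)
  then show "v * (of_rat \<beta> - left_end \<beta>) = w * (right_end \<beta> - of_rat \<beta>)"
    using q0 by simp
  show "0 \<le> left_end \<beta>" unfolding l using * v0 by simp
  have "0 < q * v" "0 < q * w" using q0 v0 w0 by simp_all
  then show lb: "left_end \<beta> < of_rat \<beta>" and br: "of_rat \<beta> < right_end \<beta>"
    using bl rb by (smt (verit) mult_nonneg_nonpos)+
  show "right_end \<beta> \<le> 1" unfolding r using * w0 w by simp
  have m: "left_nbr \<beta> \<in> farey (height \<beta>)" "right_nbr \<beta> \<in> farey (height \<beta>)"
    using left_nbr_ex1[OF assms(1,2), THEN theI'] right_nbr_ex1[OF assms(1,2), THEN theI']
    by (simp_all add: left_nbr_def right_nbr_def)
  show "left_nbr \<beta> \<in> farey (height \<beta> - 1)" "right_nbr \<beta> \<in> farey (height \<beta> - 1)"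
    using m *(1,2,3,10,12) by (auto simp: farey_def)
  have lr: "left_end \<beta> = real_of_rat (of_int u / of_int u')" "right_end \<beta> = real_of_rat (of_int p / of_int w')"
    unfolding l r v w by (simp_all only: of_rat_divide of_rat_of_int_eq)
  show h: "height \<beta> \<le> height x" if "left_end \<beta> < of_rat x" "of_rat x < right_end \<beta>" for x
  proof -
    have "u' + w' \<le> int (height x)"
      using that *(1,2,7) unfolding lr of_rat_less by (intro height_between_unimodular)
    then show ?thesis using *(3) by simp
  qed
  show "x = \<beta>" if x: "left_end \<beta> < of_rat x" "of_rat x < right_end \<beta>" "height x = height \<beta>" for x
  proof (rule ccontr)
    \<comment> \<open>On either side \<open>x\<close> lies between \<open>\<beta>\<close> and a
      parent, a unimodular pair whose denominators add up to more than the height of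
      \<open>\<beta>\<close>.\<close>
    assume "x \<noteq> \<beta>"
    then consider "x < \<beta>" | "\<beta> < x" by fastforce
    then have "int (height x) > int (height \<beta>)"
    proof cases
      case 1
      have "u' + (u' + w') \<le> int (height x)"
        using x(1) 1 *(1,2,4,7,8) unfolding lr of_rat_less
        by (intro height_between_unimodular[of _ _ a u]) (auto simp: algebra_simps)
      then show ?thesis using *(1,3) by simp
    next
      case 2
      have "(u' + w') + w' \<le> int (height x)"
        using x(2) 2 *(1,2,4,7,8) unfolding lr of_rat_less
        by (intro height_between_unimodular[of _ _ p a]) (auto simp: algebra_simps)
      then show ?thesis using *(2,3) by simp
    qed
    then show False using x(3) by simp
  qed
qed

text \<open>This agrees with \<^const>\<open>f_beta\<close> off the rationals only; the half-open pieces make it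
  measurable with respect to the Farey algebras below.\<close>

definition haar_step :: "rat \<Rightarrow> real \<Rightarrow> real" where
  "haar_step \<beta> x = real (height (left_nbr \<beta>)) * indicator {left_end \<beta>..<of_rat \<beta>} x
     - real (height (right_nbr \<beta>)) * indicator {of_rat \<beta>..<right_end \<beta>} x"

text \<open>Irrationality avoids the exceptional value of \<open>psi\<close> at integers, and the
  floor of the difference is only -1 or 0.\<close>

lemma psi_shift:
  assumes "x \<in> {0..<1}" "x \<notin> \<rat>" "\<gamma> \<in> rat_circle"
  shows "psi (x - of_rat \<gamma>) = x - of_rat \<gamma> - 1/2 + (if x < of_rat \<gamma> then 1 else 0)"
proof -
  have g: "0 \<le> real_of_rat \<gamma>" "real_of_rat \<gamma> < 1" using assms(3) by (auto simp: rat_circle_def)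
  have "x - of_rat \<gamma> \<notin> \<int>"
  proof
    assume "x - of_rat \<gamma> \<in> \<int>"
    then have "x - of_rat \<gamma> + of_rat \<gamma> \<in> \<rat>" using Ints_subset_Rats by (intro Rats_add) auto
    then show False using assms(2) by simp
  qed
  moreover have "\<lfloor>x - r\<rfloor> = (if x < r then - 1 else 0)" if "0 \<le> r" "r < 1" for r
    using assms(1) that by (auto simp: floor_eq_iff)
  ultimately show ?thesis using g by (simp add: psi_def)
qed

lemma f_beta_eq_haar_step:
  assumes "\<beta> \<in> rat_circle" "\<beta> \<noteq> 0" "x \<in> {0..<1}" "x \<notin> \<rat>"
  shows "f_beta \<beta> x = haar_step \<beta> x"
proof -
  note n = nbr_facts[OF assms(1,2)]
  have m: "left_nbr \<beta> \<in> rat_circle" "right_nbr \<beta> \<in> rat_circle" using n(8,9) by (auto simp: farey_def)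
  define v where "v = real (height (left_nbr \<beta>))"
  define w where "w = real (height (right_nbr \<beta>))"
  \<comment> \<open>If the right neighbour is 0, lifting it to 1 subtracts 1, and the jump term
    restores it because \<open>x < 1\<close>.\<close>
  have r: "psi (x - of_rat (right_nbr \<beta>)) = x - right_end \<beta> - 1/2 + (if x < right_end \<beta> then 1 else 0)"
    using psi_shift[OF assms(3,4) m(2)] assms(3) by (auto simp: right_end_def)
  have "f_beta \<beta> x = (v + w) * (x - of_rat \<beta> - 1/2 + (if x < of_rat \<beta> then 1 else 0))
     - v * (x - left_end \<beta> - 1/2 + (if x < left_end \<beta> then 1 else 0))
     - w * (x - right_end \<beta> - 1/2 + (if x < right_end \<beta> then 1 else 0))"
    using assms(2) psi_shift[OF assms(3,4,1)] psi_shift[OF assms(3,4) m(1)] r n(1)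
    by (simp add: f_beta_def v_def w_def left_end_def)
  \<comment> \<open>Slopes and halves cancel because the heights add; the shifts cancel by the
    mediant identity \<open>n(2)\<close>. Only the jumps remain.\<close>
  also have "\<dots> = (v + w) * (if x < of_rat \<beta> then 1 else 0) - v * (if x < left_end \<beta> then 1 else 0)
     - w * (if x < right_end \<beta> then 1 else 0)"
    using n(2) unfolding n(1) v_def[symmetric] w_def[symmetric] by (simp add: algebra_simps)
  also have "\<dots> = haar_step \<beta> x"
    using n(5,6) by (auto simp: haar_step_def v_def w_def indicator_def)
  finally show ?thesis .
qed

text \<open>Let \<open>\<beta> < \<gamma>\<close>. As \<open>\<beta>\<close> is not inside the open
  arc around \<open>\<gamma>\<close>, \<open>left_end \<gamma>\<close> exceeds
  \<open>left_end \<beta>\<close>. An overlap would then put the left neighbour of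
  \<open>\<gamma>\<close>, of smaller height, inside the open arc around
  \<open>\<beta>\<close>.\<close>

lemma haar_step_disjoint:
  assumes "\<beta> \<in> rat_circle" "\<beta> \<noteq> 0" "\<gamma> \<in> rat_circle" "\<gamma> \<noteq> 0" "height \<beta> = height \<gamma>" "\<beta> \<noteq> \<gamma>"
    and "x \<in> {left_end \<beta>..<right_end \<beta>}"
  shows "x \<notin> {left_end \<gamma>..<right_end \<gamma>}"
proof -
  have *: False if b: "\<beta> \<in> rat_circle" "\<beta> \<noteq> 0" and g: "\<gamma> \<in> rat_circle" "\<gamma> \<noteq> 0" and
    h: "height \<beta> = height \<gamma>" and lt: "\<beta> < \<gamma>" and
    x: "x \<in> {left_end \<beta>..<right_end \<beta>}" "x \<in> {left_end \<gamma>..<right_end \<gamma>}" for \<beta> \<gamma>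
  proof -
    note nb = nbr_facts[OF b] and ng = nbr_facts[OF g]
    have lt': "real_of_rat \<beta> < of_rat \<gamma>" using lt by (simp add: of_rat_less)
    have "\<not> (left_end \<gamma> < of_rat \<beta>)"
      using ng(11)[of \<beta>] ng(6) lt lt' h by auto
    then have 1: "left_end \<beta> < left_end \<gamma>" using nb(5) by simp
    have "left_end \<gamma> < right_end \<beta>" using x by simp
    then have "height \<beta> \<le> height (left_nbr \<gamma>)"
      using nb(10)[of "left_nbr \<gamma>"] 1 by (simp add: left_end_def)
    moreover have "height (left_nbr \<gamma>) \<le> height \<beta> - 1" using ng(8) h by (simp add: farey_def)
    ultimately show False using height_pos[of \<beta>] by simp
  qed
  show ?thesis
    using *[of \<beta> \<gamma>] *[of \<gamma> \<beta>] assms by (metis linorder_less_linear)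
qed

lemma abs_haar_step_le:
  assumes "\<beta> \<in> rat_circle" "\<beta> \<noteq> 0"
  shows "\<bar>haar_step \<beta> x\<bar> \<le> real (height \<beta>)"
  using nbr_facts(1)[OF assms] by (auto simp: haar_step_def indicator_def)

lemma haar_step_zero:
  assumes "\<beta> \<in> rat_circle" "\<beta> \<noteq> 0" "x \<notin> {left_end \<beta>..<right_end \<beta>}"
  shows "haar_step \<beta> x = 0"
  using nbr_facts(5,6)[OF assms(1,2)] assms(3) by (auto simp: haar_step_def indicator_def)

section \<open>Sums over one level\<close>

definition level_step :: "(rat \<Rightarrow> real) \<Rightarrow> nat \<Rightarrow> real \<Rightarrow> real" where
  "level_step c q x = (\<Sum>\<beta> | \<beta> \<in> rat_circle \<and> height \<beta> = q. c \<beta> * haar_step \<beta> x)"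

lemma height_zero [simp]: "height 0 = 1"
  by (simp add: height_def)

lemma U_level_eq_level_step:
  assumes "q \<ge> 2" "x \<in> {0..<1}" "x \<notin> \<rat>"
  shows "U_level c q x = level_step c q x"
  unfolding U_level_def level_step_def
proof (intro sum.cong refl)
  fix \<beta> assume b: "\<beta> \<in> {\<beta> \<in> rat_circle. height \<beta> = q}"
  then have "\<beta> \<noteq> 0" using assms(1) by auto
  then show "c \<beta> * f_beta \<beta> x = c \<beta> * haar_step \<beta> x"
    using b f_beta_eq_haar_step[OF _ _ assms(2,3)] by simp
qed

text \<open>A nonzero fraction of height 1 would have a neighbour in the empty set
  \<open>farey 0\<close>. Level 1 is thus a constant and only shifts the martingale, whose
  increments start at level 2.\<close>

lemma U_level_one: "U_level c 1 x = c 0"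
proof -
  have "\<beta> = 0" if "\<beta> \<in> rat_circle" "height \<beta> = 1" for \<beta>
  proof (rule ccontr)
    assume "\<beta> \<noteq> 0"
    then show False using nbr_facts(8)[OF that(1)] that(2) height_pos[of "left_nbr \<beta>"]
      by (auto simp: farey_def)
  qed
  then have "{\<beta> \<in> rat_circle. height \<beta> = 1} = {0}" by (auto simp: rat_circle_def)
  then show ?thesis by (simp add: U_level_def f_beta_def)
qed

text \<open>The arcs of one level are disjoint, so at each \<open>x\<close> at most one term
  survives, and the bound does not grow with the number of terms.\<close>

lemma abs_level_step_le:
  assumes "q \<ge> 2" and B: "\<And>\<beta>. \<beta> \<in> rat_circle \<Longrightarrow> \<bar>c \<beta> * real (height \<beta>)\<bar> \<le> B"
  shows "\<bar>level_step c q x\<bar> \<le> B"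
proof (cases "\<exists>\<beta>. \<beta> \<in> rat_circle \<and> height \<beta> = q \<and> x \<in> {left_end \<beta>..<right_end \<beta>}")
  case True
  then obtain \<beta> where b: "\<beta> \<in> rat_circle" "height \<beta> = q" "x \<in> {left_end \<beta>..<right_end \<beta>}" by blast
  have nz: "\<gamma> \<noteq> 0" if "height \<gamma> = q" for \<gamma> using that assms(1) by auto
  have "level_step c q x = (\<Sum>\<gamma> | \<gamma> \<in> rat_circle \<and> height \<gamma> = q. if \<gamma> = \<beta> then c \<beta> * haar_step \<beta> x else 0)"
    unfolding level_step_def
  proof (intro sum.cong refl)
    fix \<gamma> assume g: "\<gamma> \<in> {\<gamma> \<in> rat_circle. height \<gamma> = q}"
    show "c \<gamma> * haar_step \<gamma> x = (if \<gamma> = \<beta> then c \<beta> * haar_step \<beta> x else 0)"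
      using haar_step_disjoint[of \<beta> \<gamma> x] haar_step_zero[of \<gamma> x] b g nz by auto
  qed
  also have "\<dots> = c \<beta> * haar_step \<beta> x"
    using b finite_height_eq[of q] by (simp add: sum.delta)
  also have "\<bar>\<dots>\<bar> \<le> \<bar>c \<beta>\<bar> * real (height \<beta>)"
    unfolding abs_mult using b nz by (intro mult_left_mono abs_haar_step_le) auto
  also have "\<dots> \<le> B" using B[OF b(1)] by (simp add: abs_mult)
  finally show ?thesis .
next
  case False
  have "level_step c q x = (\<Sum>\<beta> | \<beta> \<in> rat_circle \<and> height \<beta> = q. 0)"
    unfolding level_step_def
  proof (intro sum.cong refl)
    fix \<gamma> assume g: "\<gamma> \<in> {\<gamma> \<in> rat_circle. height \<gamma> = q}"
    then have "\<gamma> \<noteq> 0" using assms(1) by auto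
    then show "c \<gamma> * haar_step \<gamma> x = 0" using False g haar_step_zero[of \<gamma> x] by auto
  qed
  moreover have "0 \<le> B" using B[of 0] by (auto simp: rat_circle_def)
  ultimately show ?thesis by simp
qed

section \<open>The Farey filtration\<close>

lemma space_circle_haar [simp]: "space circle_haar = {0..<1}"
  by (simp add: circle_haar_def circle_def space_restrict_space)

lemma sets_circle_haar: "A \<in> sets borel \<Longrightarrow> A \<subseteq> {0..<1} \<Longrightarrow> A \<in> sets circle_haar"
  by (auto simp: circle_haar_def circle_def sets_restrict_space)

lemma prob_space_circle_haar: "prob_space circle_haar"
  by (rule prob_spaceI)
    (simp add: circle_haar_def circle_def emeasure_restrict_space space_restrict_space)

lemma has_bochner_integral_circle_haar_Ico:
  assumes "0 \<le> a" "a \<le> b" "b \<le> 1"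
  shows "has_bochner_integral circle_haar (indicator {a..<b}) (b - a)"
proof -
  interpret prob_space circle_haar by (rule prob_space_circle_haar)
  have "{a..<b} \<in> sets circle_haar" using assms by (intro sets_circle_haar) auto
  then have "has_bochner_integral circle_haar (indicator {a..<b}) (measure circle_haar {a..<b})"
    by (intro has_bochner_integral_real_indicator) (simp_all add: less_top[symmetric])
  then show ?thesis using assms by (simp add: circle_haar_def circle_def measure_restrict_space)
qed

lemma borel_measurable_circle_haar [measurable (raw)]:
  "f \<in> borel_measurable borel \<Longrightarrow> f \<in> borel_measurable circle_haar"
  unfolding circle_haar_def by (intro measurable_restrict_space1) simp

lemma AE_circle_haar_irrational: "AE x in circle_haar. x \<notin> \<rat>"
proof -
  have "AE x in lborel. x \<notin> (\<rat>::real set)"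
    by (intro AE_not_in countable_imp_null_set_lborel countable_rat)
  then show ?thesis
    unfolding circle_haar_def by (subst AE_restrict_space_iff) (auto simp: circle_def)
qed

text \<open>These generators make the algebras visibly increase with \<open>q\<close>. Their
  differences are the half-open Farey arcs, and an endpoint 1 just gives the empty set.\<close>

definition farey_algebra :: "nat \<Rightarrow> real measure" where
  "farey_algebra q = sigma {0..<1} ((\<lambda>\<gamma>. {of_rat \<gamma>..<1}) ` farey q)"

lemma farey_generators_subset: "(\<lambda>\<gamma>. {real_of_rat \<gamma>..<1}) ` farey q \<subseteq> Pow {0..<1}"
proof (rule image_subsetI)
  fix \<gamma> assume "\<gamma> \<in> farey q"
  from farey_mem[OF this] show "{real_of_rat \<gamma>..<1} \<in> Pow {0..<1}" by (simp only: Pow_iff) auto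
qed

lemma sets_farey_algebra:
  "sets (farey_algebra q) = sigma_sets {0..<1} ((\<lambda>\<gamma>. {of_rat \<gamma>..<1}) ` farey q)"
  unfolding farey_algebra_def by (rule sets_measure_of[OF farey_generators_subset])

lemma space_farey_algebra [simp]: "space (farey_algebra q) = {0..<1}"
  unfolding farey_algebra_def by (rule space_measure_of[OF farey_generators_subset])

lemma farey_algebra_mono: "p \<le> q \<Longrightarrow> sets (farey_algebra p) \<subseteq> sets (farey_algebra q)"
  unfolding sets_farey_algebra by (intro sigma_sets_mono') (auto simp: farey_def)

lemma subalgebra_farey_algebra: "subalgebra circle_haar (farey_algebra q)"
proof -
  have "sigma_sets (space circle_haar) ((\<lambda>\<gamma>. {of_rat \<gamma>..<1}) ` farey q) \<subseteq> sets circle_haar"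
    by (rule sets.sigma_sets_subset) (use farey_generators_subset in \<open>auto intro!: sets_circle_haar\<close>)
  then show ?thesis by (simp add: subalgebra_def sets_farey_algebra)
qed

lemma farey_algebra_generator: "\<gamma> \<in> farey q \<Longrightarrow> {of_rat \<gamma>..<1} \<in> sets (farey_algebra q)"
  unfolding sets_farey_algebra by (rule sigma_sets.Basic) simp

text \<open>The sets that contain or miss \<open>I\<close> are closed under complement in [0,1) and
  countable union, so testing generators suffices.\<close>

lemma farey_algebra_atom:
  assumes "A \<in> sets (farey_algebra q)" "I \<subseteq> {0..<1}"
    and "\<And>\<gamma>. \<gamma> \<in> farey q \<Longrightarrow> I \<subseteq> {of_rat \<gamma>..<1} \<or> I \<inter> {of_rat \<gamma>..<1} = {}"
  shows "I \<subseteq> A \<or> I \<inter> A = {}"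
  using assms(1) unfolding sets_farey_algebra
proof (induction rule: sigma_sets.induct)
  case (Compl a)
  then show ?case using assms(2) by blast
next
  case (Union a)
  then show ?case by blast
qed (use assms(3) in auto)

lemma haar_step_adapted:
  assumes "\<beta> \<in> rat_circle" "\<beta> \<noteq> 0"
  shows "haar_step \<beta> \<in> borel_measurable (farey_algebra (height \<beta>))"
proof -
  let ?G = "farey_algebra (height \<beta>)"
  note n = nbr_facts[OF assms]
  have Ico: "{a..<b} \<in> sets ?G" if "{a..<1} \<in> sets ?G" "{b..<1} \<in> sets ?G" "b \<le> 1" for a b
  proof -
    have "{a..<b} = {a..<1} - {b..<1}" using that(3) by auto
    then show ?thesis using that by simp
  qed
  have "farey (height \<beta> - 1) \<subseteq> farey (height \<beta>)" by (auto simp: farey_def)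
  then have "{left_end \<beta>..<1} \<in> sets ?G" "{of_rat \<beta>..<1} \<in> sets ?G" "{right_end \<beta>..<1} \<in> sets ?G"
    using n(8,9) assms(1) farey_algebra_generator[of _ "height \<beta>"]
    by (auto simp: left_end_def right_end_def farey_def)
  then have [measurable]: "{left_end \<beta>..<of_rat \<beta>} \<in> sets ?G" "{of_rat \<beta>..<right_end \<beta>} \<in> sets ?G"
    using n(6,7) by (simp_all only: Ico less_imp_le[OF less_le_trans[OF n(6,7)]])
  show ?thesis unfolding haar_step_def[abs_def] by measurable
qed

text \<open>No fraction of smaller height lies inside the open arc, so \<open>A\<close> contains or
  misses the whole support. The integral is that of the full step, whose two pieces balance, or of
  0.\<close>

lemma haar_step_centered:
  assumes "\<beta> \<in> rat_circle" "\<beta> \<noteq> 0" and A: "A \<in> sets (farey_algebra (height \<beta> - 1))"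
  shows "(\<integral>x\<in>A. haar_step \<beta> x \<partial>circle_haar) = 0"
proof -
  interpret prob_space circle_haar by (rule prob_space_circle_haar)
  note n = nbr_facts[OF assms(1,2)]
  have "{left_end \<beta>..<right_end \<beta>} \<subseteq> A \<or> {left_end \<beta>..<right_end \<beta>} \<inter> A = {}"
  proof (rule farey_algebra_atom[OF A])
    fix \<gamma> assume "\<gamma> \<in> farey (height \<beta> - 1)"
    then have "\<not> height \<beta> \<le> height \<gamma>" using height_pos[of \<beta>] by (auto simp: farey_def)
    then have "of_rat \<gamma> \<le> left_end \<beta> \<or> right_end \<beta> \<le> of_rat \<gamma>" using n(10)[of \<gamma>] by linarith
    then show "{left_end \<beta>..<right_end \<beta>} \<subseteq> {of_rat \<gamma>..<1} \<or>
        {left_end \<beta>..<right_end \<beta>} \<inter> {of_rat \<gamma>..<1} = {}"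
      using n(7) by auto
  qed (use n(4,7) in auto)
  then show ?thesis
  proof
    assume "{left_end \<beta>..<right_end \<beta>} \<inter> A = {}"
    then have "x \<notin> {left_end \<beta>..<right_end \<beta>}" if "x \<in> A" for x
      using that by blast
    then have z: "indicator A x *\<^sub>R haar_step \<beta> x = 0" for x
      using haar_step_zero[OF assms(1,2), of x] by (simp add: indicator_def del: atLeastLessThan_iff)
    show ?thesis unfolding set_lebesgue_integral_def z by simp
  next
    assume sub: "{left_end \<beta>..<right_end \<beta>} \<subseteq> A"
    have z: "indicator A x *\<^sub>R haar_step \<beta> x = haar_step \<beta> x" for x
      using haar_step_zero[OF assms(1,2), of x] sub by (cases "x \<in> A") (auto simp del: atLeastLessThan_iff)
    have "(\<integral>x\<in>A. haar_step \<beta> x \<partial>circle_haar) = (\<integral>x. haar_step \<beta> x \<partial>circle_haar)"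
      unfolding set_lebesgue_integral_def z by (rule refl)
    also have "\<dots> = real (height (left_nbr \<beta>)) * (of_rat \<beta> - left_end \<beta>)
        - real (height (right_nbr \<beta>)) * (right_end \<beta> - of_rat \<beta>)"
      unfolding haar_step_def using n(4-7)
      by (intro has_bochner_integral_integral_eq has_bochner_integral_diff
          has_bochner_integral_mult_right has_bochner_integral_circle_haar_Ico) linarith+
    also have "\<dots> = 0" using n(3) by simp
    finally show ?thesis .
  qed
qed

lemma integrable_haar_step:
  assumes "\<beta> \<in> rat_circle" "\<beta> \<noteq> 0"
  shows "integrable circle_haar (haar_step \<beta>)"
proof -
  interpret prob_space circle_haar by (rule prob_space_circle_haar)
  show ?thesis
    using abs_haar_step_le[OF assms]
      measurable_from_subalg[OF subalgebra_farey_algebra haar_step_adapted[OF assms]]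
    by (intro integrable_const_bound[where B="real (height \<beta>)"]) auto
qed

text \<open>Increment \<open>n\<close> is level \<open>n + 2\<close>: measurable for the Farey
  algebra of order \<open>n + 2\<close> and centered over that of order
  \<open>n + 1\<close>.\<close>

lemma farey_martingale_differences:
  assumes B: "\<And>\<beta>. \<beta> \<in> rat_circle \<Longrightarrow> \<bar>c \<beta> * real (height \<beta>)\<bar> \<le> B"
  shows "bounded_martingale_differences circle_haar (\<lambda>n. farey_algebra (Suc n)) (\<lambda>n. level_step c (Suc (Suc n))) B"
proof -
  interpret prob_space circle_haar by (rule prob_space_circle_haar)
  show ?thesis
  proof unfold_locales
    show "subalgebra circle_haar (farey_algebra (Suc n))" for n
      by (rule subalgebra_farey_algebra)
    show "sets (farey_algebra (Suc m)) \<subseteq> sets (farey_algebra (Suc n))" if "m \<le> n" for m n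
      using that by (intro farey_algebra_mono) simp
    show "level_step c (Suc (Suc n)) \<in> borel_measurable (farey_algebra (Suc (Suc n)))" for n
    proof -
      have "haar_step \<beta> \<in> borel_measurable (farey_algebra (Suc (Suc n)))"
        if "\<beta> \<in> {\<beta> \<in> rat_circle. height \<beta> = Suc (Suc n)}" for \<beta>
        using that haar_step_adapted[of \<beta>] by fastforce
      then show ?thesis
        unfolding level_step_def[abs_def]
        by (intro borel_measurable_sum borel_measurable_times borel_measurable_const) auto
    qed
    show "\<bar>level_step c (Suc (Suc n)) x\<bar> \<le> B" for n x
      by (rule abs_level_step_le[OF _ B]) auto
    show "(\<integral>x\<in>A. level_step c (Suc (Suc n)) x \<partial>circle_haar) = 0" if A: "A \<in> sets (farey_algebra (Suc n))" for A n
    proof -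
      have A': "A \<in> sets circle_haar" using A subalgebra_farey_algebra by (auto simp: subalgebra_def)
      have "(\<integral>x\<in>A. level_step c (Suc (Suc n)) x \<partial>circle_haar)
          = (\<Sum>\<beta> | \<beta> \<in> rat_circle \<and> height \<beta> = Suc (Suc n). (\<integral>x\<in>A. c \<beta> * haar_step \<beta> x \<partial>circle_haar))"
        unfolding level_step_def set_lebesgue_integral_def scaleR_sum_right
      proof (rule Bochner_Integration.integral_sum)
        fix \<beta> assume b: "\<beta> \<in> {\<beta> \<in> rat_circle. height \<beta> = Suc (Suc n)}"
        then have "\<beta> \<noteq> 0" by auto
        then have "integrable circle_haar (\<lambda>x. c \<beta> * haar_step \<beta> x)"
          using b by (intro integrable_mult_right integrable_haar_step) auto
        then show "integrable circle_haar (\<lambda>x. indicat_real A x *\<^sub>R (c \<beta> * haar_step \<beta> x))"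
          by (rule integrable_mult_indicator[OF A'])
      qed
      also have "\<dots> = 0"
      proof (rule sum.neutral, rule ballI)
        fix \<beta> assume b: "\<beta> \<in> {\<beta> \<in> rat_circle. height \<beta> = Suc (Suc n)}"
        then have "\<beta> \<noteq> 0" by auto
        then show "(\<integral>x\<in>A. c \<beta> * haar_step \<beta> x \<partial>circle_haar) = 0"
          using b A haar_step_centered[of \<beta> A] by simp
      qed
      finally show ?thesis .
    qed
  qed
qed

lemma borel_measurable_psi [measurable]: "psi \<in> borel_measurable borel"
proof -
  have "(\<int>::real set) \<in> sets borel" by simp
  then show ?thesis unfolding psi_def[abs_def] by measurable
qed

lemma borel_measurable_U_level [measurable]: "U_level c q \<in> borel_measurable borel"
  unfolding U_level_def[abs_def] f_beta_def[abs_def] by measurable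

text \<open>A finite limsup would bound all late terms, and the finitely many early ones have a
  maximum.\<close>

lemma limsup_eq_infinity:
  fixes s :: "nat \<Rightarrow> real"
  assumes "\<not> bdd_above (range s)"
  shows "limsup (\<lambda>n. ereal (s n)) = \<infinity>"
proof (rule ccontr)
  assume "limsup (\<lambda>n. ereal (s n)) \<noteq> \<infinity>"
  then obtain b :: real where "limsup (\<lambda>n. ereal (s n)) < ereal b"
    by (metis less_PInf_Ex_of_nat less_ereal.simps(4) ereal_infty_less(1))
  then have "eventually (\<lambda>n. ereal (s n) < ereal b) sequentially" by (rule Limsup_lessD)
  then obtain N where N: "\<And>n. n \<ge> N \<Longrightarrow> s n < b" by (auto simp: eventually_sequentially)
  have "s n \<le> max b (Max (s ` {..N}))" for n
  proof (cases "n \<le> N")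
    case True
    then have "s n \<le> Max (s ` {..N})" by (intro Max_ge) auto
    then show ?thesis by simp
  next
    case False
    then show ?thesis using N[of n] by simp
  qed
  then have "bdd_above (range s)" by (auto simp: bdd_above_def)
  with assms show False by simp
qed

lemma liminf_eq_minus_infinity:
  fixes s :: "nat \<Rightarrow> real"
  assumes "\<not> bdd_below (range s)"
  shows "liminf (\<lambda>n. ereal (s n)) = -\<infinity>"
proof -
  have "\<not> bdd_above (range (\<lambda>n. - s n))"
  proof
    assume "bdd_above (range (\<lambda>n. - s n))"
    then obtain b where "\<And>n. - s n \<le> b" by (auto simp: bdd_above_def)
    then have "\<And>n. - b \<le> s n" by (metis minus_le_iff)
    then show False using assms by (auto simp: bdd_below_def)
  qed
  from limsup_eq_infinity[OF this] have "limsup (\<lambda>n. - ereal (s n)) = \<infinity>" by simp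
  then show ?thesis
    using ereal_Limsup_uminus[of sequentially "\<lambda>n. ereal (s n)"]
    by (metis ereal_uminus_uminus)
qed

theorem theorem10:
  fixes c :: "rat \<Rightarrow> real"
  assumes "bounded ((\<lambda>\<beta>. c \<beta> * real (height \<beta>)) ` rat_circle)"
  shows "emeasure circle_haar (set_C c \<union> set_D c) = 1
    \<and> set_C c - set_E c \<in> null_sets circle_haar
    \<and> set_E c - set_C c \<in> null_sets circle_haar"
proof -
  obtain B where B: "\<And>\<beta>. \<beta> \<in> rat_circle \<Longrightarrow> \<bar>c \<beta> * real (height \<beta>)\<bar> \<le> B"
    using assms by (auto simp: bounded_iff)
  interpret bounded_martingale_differences circle_haar "\<lambda>n. farey_algebra (Suc n)" "\<lambda>n. level_step c (Suc (Suc n))" B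
    by (rule farey_martingale_differences[OF B])
  define s where "s x Q = (\<Sum>q=1..Q. U_level c q x)" for x Q
  have C: "set_C c = {x \<in> space circle_haar. convergent (s x)}"
    by (simp add: set_C_def circle_def s_def[abs_def])
  have D: "set_D c = {x \<in> space circle_haar. liminf (\<lambda>Q. ereal (s x Q)) = -\<infinity> \<and> limsup (\<lambda>Q. ereal (s x Q)) = \<infinity>}"
    by (simp add: set_D_def circle_def s_def)
  have E: "set_E c = {x \<in> space circle_haar. summable (\<lambda>n. (U_level c (Suc n) x)\<^sup>2)}"
    by (simp add: set_E_def circle_def)
  have [measurable]: "(\<lambda>x. s x Q) \<in> borel_measurable circle_haar" for Q
    unfolding s_def by (intro borel_measurable_circle_haar) measurable
  have [measurable]: "U_level c q \<in> borel_measurable circle_haar" for q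
    by (intro borel_measurable_circle_haar) measurable
  \<comment> \<open>By completeness convergence is the Cauchy property, which is a countable
    condition.\<close>
  have mC [measurable]: "set_C c \<in> sets circle_haar"
    unfolding C Cauchy_convergent_iff[symmetric] by (rule sets_Collect_Cauchy) measurable
  have mD [measurable]: "set_D c \<in> sets circle_haar"
    unfolding D by measurable
  have mE [measurable]: "set_E c \<in> sets circle_haar"
    unfolding E summable_iff_convergent Cauchy_convergent_iff[symmetric]
    by (rule sets_Collect_Cauchy) measurable
  have key: "AE x in circle_haar. (x \<in> set_C c \<union> set_D c) \<and> x \<notin> set_C c - set_E c \<and> x \<notin> set_E c - set_C c"
    using AE_circle_haar_irrational AE_convergent_if_bdd_above AE_convergent_if_bdd_below
      AE_convergent_if_summable_squares AE_space
  proof eventually_elim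
    case (elim x)
    have x: "x \<in> {0..<1}" using elim(5) by simp
    have U: "U_level c (Suc (Suc n)) x = level_step c (Suc (Suc n)) x" for n
      by (rule U_level_eq_level_step) (use x elim(1) in auto)
    \<comment> \<open>Level 1 contributes \<open>c 0\<close>, and \<open>S n\<close> covers the
      levels 2 to \<open>n + 1\<close>.\<close>
    have s: "s x (Suc n) = c 0 + S n x" for n
      unfolding s_def
      by (induction n) (use U U_level_one in \<open>auto simp: S_def\<close>)
    have conv: "convergent (s x) \<longleftrightarrow> convergent (\<lambda>n. S n x)"
      unfolding convergent_Suc_iff[of "s x", symmetric] s by (rule convergent_add_const_iff)
    have sq: "summable (\<lambda>n. (U_level c (Suc n) x)\<^sup>2) \<longleftrightarrow> summable (\<lambda>n. (level_step c (Suc (Suc n)) x)\<^sup>2)"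
      using U by (subst summable_Suc_iff[symmetric]) simp
    have above: "bdd_above (range (\<lambda>n. S n x))" if bdd: "bdd_above (range (s x))"
    proof -
      obtain b where "\<And>n. s x n \<le> b" using bdd by (auto simp: bdd_above_def)
      then have "S n x \<le> b - c 0" for n using s[of n] by (metis add.commute le_diff_eq)
      then show ?thesis by (auto simp: bdd_above_def)
    qed
    have below: "bdd_below (range (\<lambda>n. S n x))" if bdd: "bdd_below (range (s x))"
    proof -
      obtain b where "\<And>n. b \<le> s x n" using bdd by (auto simp: bdd_below_def)
      then have "b - c 0 \<le> S n x" for n using s[of n] by (metis add.commute diff_le_eq)
      then show ?thesis by (auto simp: bdd_below_def)
    qed
    have "x \<in> set_C c \<union> set_D c"
    \<comment> \<open>A bound on one side yields convergence off the null set; without any bound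
      both extreme limits are infinite.\<close>
    proof (cases "bdd_above (range (s x)) \<or> bdd_below (range (s x))")
      case True
      then have "convergent (s x)" 
        unfolding conv using elim(2,3) above below by metis
      then show ?thesis using elim(5) by (simp add: C)
    next
      case False
      then show ?thesis
        using limsup_eq_infinity[of "s x"] liminf_eq_minus_infinity[of "s x"] elim(5)
        by (simp add: D)
    qed
    moreover have "x \<in> set_E c" if "x \<in> set_C c"
    proof -
      have "convergent (\<lambda>n. S n x)" using that conv by (simp add: C)
      then obtain l where "(\<lambda>n. S n x) \<longlonglongrightarrow> l" by (auto simp: convergent_def)
      \<comment> \<open>Convergence enters only through this bound: the one-sided criterion also
        gives summable squares.\<close>
      then have "bdd_above (range (\<lambda>n. S n x))"
        by (rule bounded_imp_bdd_above[OF convergent_imp_bounded])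
      then show ?thesis using elim(2) elim(5) sq by (simp add: E)
    qed
    moreover have "x \<in> set_C c" if "x \<in> set_E c"
      using that elim(4,5) sq conv by (simp add: C E)
    ultimately show ?case by blast
  qed
  have "AE x in circle_haar. x \<in> set_C c \<union> set_D c" using key by eventually_elim blast
  then have "prob (set_C c \<union> set_D c) = 1"
    by (subst prob_eq_1) auto
  moreover have "set_C c - set_E c \<in> null_sets circle_haar"
    using key by (subst AE_iff_null_sets) auto
  moreover have "set_E c - set_C c \<in> null_sets circle_haar"
    using key by (subst AE_iff_null_sets) auto
  ultimately show ?thesis by (simp add: emeasure_eq_measure)
qed

end
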